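(* Let $C$ be a circular fence of size $n$ whose Hasse diagram is a cycle; that is, $C=C_\delta$ for some $\delta\in\{+,-\}^n$ in which both signs occur at least twice. Then $$n!\,\Omega(C;t)=\sum_{\sigma\in S_n}t^{\operatorname{bl}^{\circ}_{C}(\sigma)}.$$
   Context: Subscripts are read modulo $n$. For $\delta\in\{+,-\}^n$ with both signs occurring, $C_\delta$ is the poset on $\{y_1,\ldots,y_n\}$ that is the transitive closure of the relations $y_j\succ y_{j+1}$ if $\delta_j=+$, and $y_j\prec y_{j+1}$ if $\delta_j=-$, for $j$ modulo $n$. Its undirected Hasse diagram is a cycle exactly when both signs occur at least twice. Order polynomial: for a finite poset $P$, $\Omega(P;t)$ is the polynomial with $\Omega(P;m)=\#\{f:P\to[m]\text{ (weakly) order-preserving}\}$ for all positive integers $m$. Circular block statistic (Kahane). Let $\sigma\in S_n$ and label $y_j$ by $\sigma_j$. Call $y_j$ an ascent vertex if $y_{j-1}\prec y_j$ (i.e. $\delta_{j-1}=-$) and a descent vertex if $y_{j-1}\succ y_j$ (i.e. $\delta_{j-1}=+$). A circular block partition is a partition of the vertices of the cycle into cyclic intervals of consecutive vertices (blocks). When there are at least two blocks, the root of a block is its first vertex in the forward cyclic direction (increasing index modulo $n$), and the partition is valid if: (i) within each block, every non-root ascent vertex has label smaller than the root's label, and every non-root descent vertex has label larger than the root's label; and (ii) whenever block $B'$ immediately follows block $B$ cyclically, the label of the root of $B'$ is larger than the label of the root of $B$ if the root of $B'$ is an ascent vertex, and smaller if it is a descent vertex. The partition with a single block (the whole cycle)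 is given as root the ascent vertex with largest label, and it is valid if condition (i) holds for it. For each $\sigma$ there is exactly one valid circular block partition; $\operatorname{bl}^{\circ}_{C}(\sigma)$ is its number of blocks. *)

theory Defs
  imports
    "HOL-Computational_Algebra.Polynomial"
    "HOL-Library.FuncSet"
    "HOL-Library.Disjoint_Sets"
    "HOL-Combinatorics.Permutations"
begin

(* A poset on A is given by its weak order r, where (x, y) \<in> r means x \<le> y
   (partial_order_on A r). *)
definition order_preserving_maps :: "'a set \<Rightarrow> 'a rel \<Rightarrow> nat \<Rightarrow> ('a \<Rightarrow> nat) set" where
  "order_preserving_maps A r m =
     {f \<in> A \<rightarrow>\<^sub>E {1..m}. \<forall>(x, y) \<in> r. f x \<le> f y}"

definition order_polynomial :: "'a set \<Rightarrow> 'a rel \<Rightarrow> rat poly" where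
  "order_polynomial A r =
     (THE p. \<forall>m\<ge>1. poly p (of_nat m) = of_nat (card (order_preserving_maps A r m)))"

datatype sign = Plus | Minus

(* A sign vector of length n is a list \<delta>. The vertices y_1, ..., y_n are represented by
   the indices 0, ..., n - 1, and the labels 1, ..., n of a permutation likewise by
   0, ..., n - 1. *)
abbreviation vertices :: "sign list \<Rightarrow> nat set" where
  "vertices \<delta> \<equiv> {..<length \<delta>}"

definition next_vertex :: "sign list \<Rightarrow> nat \<Rightarrow> nat" where
  "next_vertex \<delta> j = (j + 1) mod length \<delta>"

definition prev_vertex :: "sign list \<Rightarrow> nat \<Rightarrow> nat" where
  "prev_vertex \<delta> j = (j + length \<delta> - 1) mod length \<delta>"

definition fence_steps :: "sign list \<Rightarrow> nat rel" where
  "fence_steps \<delta> =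
     {(next_vertex \<delta> j, j) | j. j \<in> vertices \<delta> \<and> \<delta> ! j = Plus} \<union>
     {(j, next_vertex \<delta> j) | j. j \<in> vertices \<delta> \<and> \<delta> ! j = Minus}"

(* The weak order of C_\<delta>; its strict part is the transitive closure of the steps. *)
definition circular_fence :: "sign list \<Rightarrow> nat rel" where
  "circular_fence \<delta> = Id_on (vertices \<delta>) \<union> (fence_steps \<delta>)\<^sup>+"

definition ascent_vertex :: "sign list \<Rightarrow> nat \<Rightarrow> bool" where
  "ascent_vertex \<delta> j \<longleftrightarrow> \<delta> ! prev_vertex \<delta> j = Minus"

definition descent_vertex :: "sign list \<Rightarrow> nat \<Rightarrow> bool" where
  "descent_vertex \<delta> j \<longleftrightarrow> \<delta> ! prev_vertex \<delta> j = Plus"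

definition cyclic_interval :: "sign list \<Rightarrow> nat \<Rightarrow> nat \<Rightarrow> nat set" where
  "cyclic_interval \<delta> s k = (\<lambda>i. (s + i) mod length \<delta>) ` {..<k}"

definition circular_block_partition :: "sign list \<Rightarrow> nat set set \<Rightarrow> bool" where
  "circular_block_partition \<delta> P \<longleftrightarrow>
     partition_on (vertices \<delta>) P \<and>
     (\<forall>B\<in>P. \<exists>s \<in> vertices \<delta>. \<exists>k. 1 \<le> k \<and> k \<le> length \<delta> \<and> B = cyclic_interval \<delta> s k)"

(* The whole cycle is a block only of the one-block partition. In the other branch B is a
   proper cyclic interval, so its first vertex is unique. *)
definition block_root :: "sign list \<Rightarrow> (nat \<Rightarrow> nat) \<Rightarrow> nat set \<Rightarrow> nat" where
  "block_root \<delta> \<sigma> B =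
     (if B = vertices \<delta>
      then arg_max \<sigma> (\<lambda>j. j \<in> vertices \<delta> \<and> ascent_vertex \<delta> j)
      else (THE s. s \<in> vertices \<delta> \<and> (\<exists>k\<ge>1. B = cyclic_interval \<delta> s k)))"

definition block_condition :: "sign list \<Rightarrow> (nat \<Rightarrow> nat) \<Rightarrow> nat set \<Rightarrow> bool" where
  "block_condition \<delta> \<sigma> B \<longleftrightarrow>
     (\<forall>j \<in> B - {block_root \<delta> \<sigma> B}.
        (ascent_vertex \<delta> j \<longrightarrow> \<sigma> j < \<sigma> (block_root \<delta> \<sigma> B)) \<and>
        (descent_vertex \<delta> j \<longrightarrow> \<sigma> j > \<sigma> (block_root \<delta> \<sigma> B)))"

(* Used only for partitions with at least two blocks: B' starts right after B ends. *)
definition follows_block :: "sign list \<Rightarrow> (nat \<Rightarrow> nat) \<Rightarrow> nat set \<Rightarrow> nat set \<Rightarrow> bool" where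
  "follows_block \<delta> \<sigma> B B' \<longleftrightarrow> prev_vertex \<delta> (block_root \<delta> \<sigma> B') \<in> B"

definition root_condition :: "sign list \<Rightarrow> (nat \<Rightarrow> nat) \<Rightarrow> nat set set \<Rightarrow> bool" where
  "root_condition \<delta> \<sigma> P \<longleftrightarrow>
     (\<forall>B\<in>P. \<forall>B'\<in>P. follows_block \<delta> \<sigma> B B' \<longrightarrow>
        (ascent_vertex \<delta> (block_root \<delta> \<sigma> B') \<longrightarrow>
           \<sigma> (block_root \<delta> \<sigma> B') > \<sigma> (block_root \<delta> \<sigma> B)) \<and>
        (descent_vertex \<delta> (block_root \<delta> \<sigma> B') \<longrightarrow>
           \<sigma> (block_root \<delta> \<sigma> B') < \<sigma> (block_root \<delta> \<sigma> B)))"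

definition valid_block_partition :: "sign list \<Rightarrow> (nat \<Rightarrow> nat) \<Rightarrow> nat set set \<Rightarrow> bool" where
  "valid_block_partition \<delta> \<sigma> P \<longleftrightarrow>
     circular_block_partition \<delta> P \<and>
     (\<forall>B\<in>P. block_condition \<delta> \<sigma> B) \<and>
     (2 \<le> card P \<longrightarrow> root_condition \<delta> \<sigma> P)"

definition bl_circ :: "sign list \<Rightarrow> (nat \<Rightarrow> nat) \<Rightarrow> nat" where
  "bl_circ \<delta> \<sigma> = card (THE P. valid_block_partition \<delta> \<sigma> P)"

lemma partial_order_on_circular_fence:
  assumes "Plus \<in> set \<delta>" and "Minus \<in> set \<delta>"
  shows "partial_order_on (vertices \<delta>) (circular_fence \<delta>)"
proof -
  let ?n = "length \<delta>"
  define c :: "sign \<Rightarrow> int" where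
    "c s = (case s of Plus \<Rightarrow> - int (count_list \<delta> Minus) | Minus \<Rightarrow> int (count_list \<delta> Plus))" for s
  define h where "h j = (\<Sum>i<j. c (\<delta> ! i))" for j
  have n: "?n > 0" using assms by auto
  have pos: "count_list \<delta> Plus > 0" "count_list \<delta> Minus > 0"
    using assms by (simp_all add: count_list_0_iff Nat.neq0_conv[symmetric] del: Nat.neq0_conv)
  have "sum_list (map c xs) = int (count_list xs Minus) * int (count_list \<delta> Plus)
          - int (count_list xs Plus) * int (count_list \<delta> Minus)" for xs
    by (induction xs) (auto simp: c_def algebra_simps split: sign.splits intro: sign.exhaust)
  from this[of \<delta>] have "h ?n = 0"
    by (simp add: h_def sum_list_sum_nth atLeast0LessThan algebra_simps)
  moreover have "h 0 = 0" "h (Suc j) = h j + c (\<delta> ! j)" for j by (simp_all add: h_def)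
  ultimately have h_next: "h (next_vertex \<delta> j) = h j + c (\<delta> ! j)" if "j < ?n" for j
    using that by (cases "Suc j = ?n") (auto simp: next_vertex_def, metis)
  have step: "h x < h y \<and> x < ?n \<and> y < ?n" if "(x, y) \<in> fence_steps \<delta>" for x y
    using that n pos unfolding fence_steps_def
    by (auto simp: h_next c_def) (auto simp: next_vertex_def)
  have tc: "h x < h y \<and> x < ?n \<and> y < ?n" if "(x, y) \<in> (fence_steps \<delta>)\<^sup>+" for x y
    using that by (induction rule: trancl_induct) (use step in fastforce)+
  show ?thesis
    unfolding partial_order_on_def preorder_on_def refl_on_def
  proof (intro conjI)
    show "trans (circular_fence \<delta>)"
      unfolding circular_fence_def by (rule transI) (auto intro: trancl_trans)
    show "antisym (circular_fence \<delta>)"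
      unfolding circular_fence_def by (rule antisymI) (auto dest!: tc)
  qed (auto simp: circular_fence_def dest: tc)
qed

end

theory Submission
  imports Defs
begin

text \<open>
  Read the vertices of the cycle in order and remember the label of the root of the current
  block. An ascent vertex with label \<open>u\<close> changes the remembered label \<open>x\<close> to \<open>max x u\<close>, a
  descent vertex changes it to \<open>min x u\<close>, and the roots are the vertices whose own label is the
  new value: this is what conditions (i) and (ii) say. A valid circular block partition therefore
  yields a solution of these recursions that closes up around the cycle and has labels as values,
  and its blocks are the sets on which the solution is constant. Once around the cycle, the
  remembered label undergoes a composition \<open>F\<close> of maps \<open>max _ u\<close> and \<open>min _ u\<close>. Such an \<open>F\<close>
  is a clamp: it is idempotent, so it has a fixed point among the labels, and two different fixed
  points force every single step to fix both of them. Then all solutions are constant, and the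
  partition has one block. So in every case all closed solutions have the same sets of constancy,
  which gives existence and uniqueness of the valid partition (\<open>bl_circ_eq_cyc_roots\<close>).

  As a polynomial is determined by its values at the positive integers, it remains to prove the
  identity at \<open>t = m\<close> for natural numbers \<open>m \<ge> 1\<close>. Order-preserving maps are closed walks in
  \<open>{..<m}\<close> with weakly rising and falling steps. The main tool is to flip one sign of the cyclic
  word. The weakly rising and the weakly falling steps together comprise every pair of values
  once, and the pairs of equal values once more. Hence the two counts of closed walks add up to
  the count of open walks along the path obtained by deleting the step, plus the count of closed
  walks on the contracted cycle. The block statistic satisfies the same relation for each
  individual labelling (\<open>flip_root_count\<close>): of \<open>max x u\<close> and \<open>min x u\<close>, one makes the flipped
  vertex a root, as in the path, and the other one ignores it, as in the contraction. Flipping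
  signs one after the other reduces everything to the word with all signs \<open>Minus\<close>, where both
  sides are immediate.

  The flip needs the analogous theorem for paths. To prove it, the \<open>n\<close> labels are chosen out of a
  set \<open>Q\<close> of \<open>n + m - 1\<close> points, and the \<open>m - 1\<close> points left over are regarded as walls which cut
  the line into \<open>m\<close> cells. Averaged over all choices, a remembered label with weight \<open>m\<close> for each
  new root behaves exactly like a walk on the numbers of the cells (\<open>wall_exchange\<close>,
  \<open>sum_root_count_walls\<close>). This is a discrete form of the fact that in the basis of Bernstein
  polynomials of degree \<open>m - 1\<close> the operators \<open>g \<mapsto> m \<integral>\<^sub>x\<^sup>1 g + x g\<close> and
  \<open>g \<mapsto> m \<integral>\<^sub>0\<^sup>x g + (1 - x) g\<close> are the triangular matrices whose nonzero entries are all 1, that is,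
  the operators of a weakly rising and a weakly falling step.
\<close>

section \<open>The label of the current root\<close>

text \<open>
  The label of the current root after a vertex with label \<open>u\<close>, if it was \<open>x\<close> before. The sign
  is that of the edge into the vertex, so \<open>Minus\<close> stands for an ascent vertex. In an ascent
  vertex, conditions (i) and (ii) say that \<open>u < x\<close> inside a block and \<open>u > x\<close> for a new root.
\<close>
fun root_step :: "sign \<Rightarrow> nat \<Rightarrow> nat \<Rightarrow> nat" where
  "root_step Minus x u = max x u"
| "root_step Plus x u = min x u"

fun run :: "sign list \<Rightarrow> nat list \<Rightarrow> nat \<Rightarrow> nat" where
  "run (a # w) (u # l) x = run w l (root_step a x u)"
| "run _ _ x = x"

fun root_count :: "sign list \<Rightarrow> nat list \<Rightarrow> nat \<Rightarrow> nat" where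
  "root_count (a # w) (u # l) x =
     (if root_step a x u = u then 1 else 0) + root_count w l (root_step a x u)"
| "root_count _ _ x = 0"

text \<open>
  By \<open>run_idem\<close> a run from any start ends in a fixed point of \<open>run w l\<close>, and by
  \<open>cyc_roots_eq\<close> every fixed point among the labels yields the same count; starting at \<open>hd l\<close> is
  just one way to find such a fixed point.
\<close>
definition cyc_roots :: "sign list \<Rightarrow> nat list \<Rightarrow> nat" where
  "cyc_roots w l = root_count w l (run w l (hd l))"

lemma run_in: "run w l x \<in> insert x (set l)"
proof (induction w l x rule: run.induct)
  case (1 a w u l x)
  have "root_step a x u \<in> {x, u}" by (cases a) (auto simp: max_def min_def)
  with 1 show ?case by auto
qed auto

lemma run_append:
  assumes "length w = length l"
  shows "run (w @ w') (l @ l') x = run w' l' (run w l x)"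
  using assms by (induction w l arbitrary: x rule: list_induct2) auto

lemma root_count_append:
  assumes "length w = length l"
  shows "root_count (w @ w') (l @ l') x = root_count w l x + root_count w' l' (run w l x)"
  using assms by (induction w l arbitrary: x rule: list_induct2) auto

text \<open>
  By distributivity, a step \<open>max _ u\<close> or \<open>min _ u\<close> cannot lift the upper run above
  \<open>max c\<close> of the lower one. With \<open>run_ge_min\<close> this says that \<open>run w l\<close> is a clamp, without
  naming its bounds.
\<close>
lemma run_le_max: "y \<le> max c x \<Longrightarrow> run w l y \<le> max c (run w l x)"
proof (induction w l x arbitrary: y rule: run.induct)
  case (1 a w u l x)
  have "root_step a y u \<le> max c (root_step a x u)"
    using 1(2) by (cases a) auto
  with 1(1) show ?case by simp
qed auto

lemma run_ge_min: "min c x \<le> y \<Longrightarrow> min c (run w l x) \<le> run w l y"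
proof (induction w l x arbitrary: y rule: run.induct)
  case (1 a w u l x)
  have "min c (root_step a x u) \<le> root_step a y u"
    using 1(2) by (cases a) auto
  with 1(1) show ?case by simp
qed auto

text \<open>
  Put \<open>z = run w l y\<close>. Since \<open>z \<le> max z y\<close>, one more run leads from \<open>z\<close> at most to
  \<open>max z z\<close>, and dually at least to \<open>min z z\<close>.
\<close>
lemma run_idem: "run w l (run w l y) = run w l y"
proof (rule antisym)
  show "run w l (run w l y) \<le> run w l y"
    using run_le_max[of "run w l y" "run w l y" y w l] by simp
  show "run w l y \<le> run w l (run w l y)"
    using run_ge_min[of "run w l y" y "run w l y" w l] by simp
qed

text \<open>
  A step that does not merge \<open>x\<close> and \<open>y\<close> can only move them towards each other.
\<close>
lemma run_separated:
  assumes "run w l x < run w l y"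
  shows "x \<le> run w l x \<and> run w l y \<le> y \<and> x < y"
  using assms
proof (induction w l x arbitrary: y rule: run.induct)
  case (1 a w u l x)
  have *: "root_step a x u \<le> run w l (root_step a x u) \<and>
     run w l (root_step a y u) \<le> root_step a y u \<and> root_step a x u < root_step a y u"
    using 1 by simp
  then have "x \<le> root_step a x u \<and> root_step a y u \<le> y \<and> x < y"
    by (cases a) (auto simp: max_def min_def split: if_splits)
  with * show ?case by force
qed auto

text \<open>
  Runs from \<open>x < y\<close> that return to \<open>x\<close> and \<open>y\<close> never merge, hence only move towards each
  other; as both come back, neither moves at all.
\<close>
lemma run_two_fixed:
  assumes "run w l x = x" "run w l y = y" "x < y" "(a, u) \<in> set (zip w l)"
  shows "root_step a x u = x \<and> root_step a y u = y"
  using assms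
proof (induction w l x arbitrary: y rule: run.induct)
  case (1 b w v l x)
  have *: "root_step b x v \<le> x \<and> y \<le> root_step b y v \<and> root_step b x v < root_step b y v"
    using run_separated[of w l "root_step b x v" "root_step b y v"] 1(2-4) by simp
  then have "x \<le> root_step b x v \<and> root_step b y v \<le> y"
    by (cases b) (auto simp: max_def min_def split: if_splits)
  then have "root_step b x v = x" "root_step b y v = y" using * by auto
  with 1 show ?case by auto
qed auto

lemma root_count_const:
  assumes "length w = length l" "\<And>a u. (a, u) \<in> set (zip w l) \<Longrightarrow> root_step a x u = x"
  shows "root_count w l x = count_list l x"
  using assms by (induction w l rule: list_induct2) auto

lemma count_list_distinct: "distinct l \<Longrightarrow> x \<in> set l \<Longrightarrow> count_list l x = 1"
  by (induction l) (auto simp: count_list_0_iff)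

text \<open>
  Two different fixed points are left alone by all steps, so each of them is counted only at the
  vertex that carries it.
\<close>
lemma root_count_fixed_unique:
  assumes "length w = length l" "distinct l" "x \<in> set l" "y \<in> set l"
    "run w l x = x" "run w l y = y"
  shows "root_count w l x = root_count w l y"
proof -
  have *: "root_count w l x = root_count w l y"
    if "x < y" "x \<in> set l" "y \<in> set l" "run w l x = x" "run w l y = y" for x y
  proof -
    have "count_list l x = count_list l y"
      using that(2,3) assms(2) by (simp add: count_list_distinct)
    then show ?thesis
      using root_count_const[OF assms(1), of x] root_count_const[OF assms(1), of y]
        run_two_fixed[OF that(4,5,1)] by auto
  qed
  show ?thesis using *[of x y] *[of y x] assms(3-) by (metis linorder_neqE_nat)
qed

lemma cyc_roots_eq:
  assumes "length w = length l" "distinct l" "x \<in> set l" "run w l x = x"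
  shows "cyc_roots w l = root_count w l x"
proof -
  have "l \<noteq> []" using assms by auto
  then have "run w l (hd l) \<in> set l" using run_in[of w l "hd l"] by auto
  then show ?thesis unfolding cyc_roots_def
    by (intro root_count_fixed_unique assms) (auto simp: run_idem)
qed

text \<open>
  Let \<open>x\<close> be a fixed point of the contracted cycle. If \<open>x < u\<close>, then \<open>min x u = x\<close> and the
  word with \<open>Plus\<close> has the same closed run as the contracted one. Moreover \<open>run w l u \<le> u\<close> by
  \<open>run_le_max\<close>, so the word with \<open>Minus\<close> puts \<open>u\<close> back after each turn and has the
  run of the path that starts with the root \<open>u\<close>. If \<open>x > u\<close>, the signs exchange their roles.
\<close>
lemma flip_root_count:
  assumes "length w = length l" "distinct (u # l)" "l \<noteq> []"
  shows "(t::nat) ^ cyc_roots (Minus # w) (u # l) + t ^ cyc_roots (Plus # w) (u # l) =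
         t ^ (1 + root_count w l u) + t ^ cyc_roots w l"
proof -
  define x where "x = run w l (hd l)"
  have x: "x \<in> set l" "run w l x = x"
    using run_in[of w l "hd l"] assms(3) by (auto simp: x_def run_idem)
  have cx: "cyc_roots w l = root_count w l x"
    by (rule cyc_roots_eq) (use assms x in auto)
  have xu: "x \<noteq> u" using x assms by auto
  have v: "run w l u \<in> set (u # l)" using run_in[of w l u] by auto
  show ?thesis
  proof (cases "x < u")
    case True
    have le: "run w l u \<le> u" using run_le_max[of u u x w l] x True by simp
    have "cyc_roots (Minus # w) (u # l) = root_count (Minus # w) (u # l) (run w l u)"
      by (rule cyc_roots_eq) (use assms v le in \<open>auto simp: max_absorb2\<close>)
    moreover have "cyc_roots (Plus # w) (u # l) = root_count (Plus # w) (u # l) x"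
      by (rule cyc_roots_eq) (use assms x True in auto)
    ultimately show ?thesis using le True xu cx by (simp add: max_absorb2 min_absorb1)
  next
    case False
    have le: "u \<le> run w l u" using run_ge_min[of u x u w l] x False by simp
    have "cyc_roots (Plus # w) (u # l) = root_count (Plus # w) (u # l) (run w l u)"
      by (rule cyc_roots_eq) (use assms v le in \<open>auto simp: min_absorb2\<close>)
    moreover have "cyc_roots (Minus # w) (u # l) = root_count (Minus # w) (u # l) x"
      by (rule cyc_roots_eq) (use assms x False in auto)
    ultimately show ?thesis using le False xu cx by (simp add: max_absorb1 min_absorb2)
  qed
qed

lemma cyc_roots_rotate:
  assumes "length w = length l" "distinct (u # l)"
  shows "cyc_roots (a # w) (u # l) = cyc_roots (w @ [a]) (l @ [u])"
proof -
  define x where "x = run (a # w) (u # l) u"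
  have x: "x \<in> set (u # l)" "run (a # w) (u # l) x = x"
    using run_in[of "a # w" "u # l" u] run_idem[of "a # w" "u # l" u] unfolding x_def by auto
  \<comment> \<open>The closed run, entered one vertex later.\<close>
  define y where "y = root_step a x u"
  have y: "y \<in> set (l @ [u])" using x(1) by (cases a) (auto simp: y_def max_def min_def)
  have xy: "run w l y = x" using x(2) by (simp add: y_def)
  have fy: "run (w @ [a]) (l @ [u]) y = y"
    using assms xy by (simp add: run_append y_def)
  have "cyc_roots (a # w) (u # l) = root_count (a # w) (u # l) x"
    by (rule cyc_roots_eq) (use assms x in auto)
  moreover have "cyc_roots (w @ [a]) (l @ [u]) = root_count (w @ [a]) (l @ [u]) y"
    by (rule cyc_roots_eq) (use assms fy y in auto)
  ultimately show ?thesis using assms xy by (simp add: root_count_append y_def)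
qed

text \<open>
  With ascents only, the largest label is never replaced.
\<close>
lemma run_replicate_Minus:
  "\<forall>u\<in>set l. u \<le> x \<Longrightarrow> run (replicate (length l) Minus) l x = x"
  by (induction l) (simp_all add: max_absorb1)

lemma cyc_roots_replicate_Minus:
  assumes "distinct l" "l \<noteq> []"
  shows "cyc_roots (replicate (length l) Minus) l = 1"
proof -
  let ?x = "Max (set l)"
  have x: "?x \<in> set l" using assms by simp
  have "cyc_roots (replicate (length l) Minus) l = root_count (replicate (length l) Minus) l ?x"
    by (intro cyc_roots_eq x assms run_replicate_Minus) auto
  also have "\<dots> = count_list l ?x"
  proof (rule root_count_const)
    fix a u assume "(a, u) \<in> set (zip (replicate (length l) Minus) l)"
    then have "a = Minus" "u \<in> set l" using set_zip_leftD set_zip_rightD by fastforce+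
    then show "root_step a ?x u = ?x" by (simp add: max_absorb1)
  qed simp
  finally show ?thesis using x assms by (simp add: count_list_distinct)
qed

lemma cyc_roots_single: "cyc_roots [a] [u] = 1"
  by (cases a) (auto simp: cyc_roots_def)

lemma run_root_count_map:
  assumes "length w = length l" "strict_mono_on S f" "x \<in> S" "set l \<subseteq> S"
  shows "run w (map f l) (f x) = f (run w l x) \<and> root_count w (map f l) (f x) = root_count w l x"
  using assms(1,3,4)
proof (induction w l arbitrary: x rule: list_induct2)
  case (Cons a w u l)
  have inj: "inj_on f S"
    using assms(2) by (rule strict_mono_on_imp_inj_on)
  have y: "root_step a x u \<in> S" using Cons by (cases a) (auto simp: max_def min_def)
  have e: "root_step a (f x) (f u) = f (root_step a x u)"
    using assms(2) Cons(3,4)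
    by (cases a) (auto simp: max_def min_def strict_mono_on_less_eq)
  have "f (root_step a x u) = f u \<longleftrightarrow> root_step a x u = u"
    using inj y Cons(4) by (auto dest: inj_onD)
  then show ?case using Cons y e by simp
qed auto

lemma cyc_roots_map:
  assumes "length w = length l" "strict_mono_on (set l) f" "l \<noteq> []"
  shows "cyc_roots w (map f l) = cyc_roots w l"
  unfolding cyc_roots_def
  using run_root_count_map[OF assms(1,2), of "hd l"] run_root_count_map[OF assms(1,2), of "run w l (hd l)"]
    run_in[of w l "hd l"] assms(3) by (auto simp: hd_map insert_absorb)

section \<open>Walks with prescribed steps\<close>

fun allowed :: "sign \<Rightarrow> nat \<Rightarrow> nat \<Rightarrow> bool" where
  "allowed Minus i j \<longleftrightarrow> i \<le> j"
| "allowed Plus i j \<longleftrightarrow> j \<le> i"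

fun walks :: "nat \<Rightarrow> sign list \<Rightarrow> nat \<Rightarrow> nat \<Rightarrow> nat" where
  "walks m [] i k = (if i = k then 1 else 0)"
| "walks m (a # w) i k = (\<Sum>j | j < m \<and> allowed a i j. walks m w j k)"

definition walks_from :: "nat \<Rightarrow> sign list \<Rightarrow> nat \<Rightarrow> nat" where
  "walks_from m w i = (\<Sum>k<m. walks m w i k)"

definition closed_walks :: "nat \<Rightarrow> sign list \<Rightarrow> nat" where
  "closed_walks m w = (\<Sum>i<m. walks m w i i)"

lemma walks_from_Cons:
  "walks_from m (a # w) i = (\<Sum>j | j < m \<and> allowed a i j. walks_from m w j)"
  unfolding walks_from_def by (simp add: sum.swap[of _ "{..<m}"])

text \<open>
  The ranges of a rising and of a falling step cover \<open>{..<m}\<close> and overlap in the value that the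
  walk comes from.
\<close>
lemma flip_closed_walks:
  "closed_walks m (Minus # w) + closed_walks m (Plus # w) =
   (\<Sum>i<m. walks_from m w i) + closed_walks m w"
proof -
  have "(\<Sum>j | j < m \<and> i \<le> j. walks m w j i) + (\<Sum>j | j < m \<and> j \<le> i. walks m w j i) =
        (\<Sum>j<m. walks m w j i) + walks m w i i" if "i < m" for i
  proof -
    have "{j. j < m \<and> i \<le> j} \<union> {j. j < m \<and> j \<le> i} = {..<m}"
      "{j. j < m \<and> i \<le> j} \<inter> {j. j < m \<and> j \<le> i} = {i}" using that by auto
    then show ?thesis
      using sum.union_inter[of "{j. j < m \<and> i \<le> j}" "{j. j < m \<and> j \<le> i}" "\<lambda>j. walks m w j i"]
      by simp
  qed
  then have "closed_walks m (Minus # w) + closed_walks m (Plus # w) =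
      (\<Sum>i<m. (\<Sum>j<m. walks m w j i) + walks m w i i)"
    unfolding closed_walks_def by (simp flip: sum.distrib)
  also have "\<dots> = (\<Sum>i<m. walks_from m w i) + closed_walks m w"
    unfolding sum.distrib closed_walks_def walks_from_def by (subst sum.swap) simp
  finally show ?thesis .
qed

lemma walks_snoc:
  assumes "i < m" "k < m"
  shows "walks m (w @ [a]) i k = (\<Sum>j | j < m \<and> allowed a j k. walks m w i j)"
  using assms(1)
proof (induction w arbitrary: i)
  case Nil
  then show ?case using assms(2) by (simp add: sum.delta')
next
  case (Cons b w)
  then have "walks m ((b # w) @ [a]) i k =
      (\<Sum>j | j < m \<and> allowed b i j. \<Sum>h | h < m \<and> allowed a h k. walks m w j h)" by simp
  then show ?case by (subst (asm) sum.swap) simp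
qed

lemma closed_walks_rotate: "closed_walks m (w @ [a]) = closed_walks m (a # w)"
proof -
  have "closed_walks m (w @ [a]) = (\<Sum>i<m. \<Sum>j | j \<in> {..<m} \<and> allowed a j i. walks m w i j)"
    unfolding closed_walks_def by (simp add: walks_snoc)
  also have "\<dots> = (\<Sum>j<m. \<Sum>i | i \<in> {..<m} \<and> allowed a j i. walks m w i j)"
    by (rule sum.swap_restrict) auto
  finally show ?thesis by (simp add: closed_walks_def)
qed

lemma walks_replicate_Minus:
  "k \<le> i \<Longrightarrow> i < m \<Longrightarrow> walks m (replicate n Minus) i k = (if i = k then 1 else 0)"
proof (induction n arbitrary: i)
  case (Suc n)
  have "walks m (replicate (Suc n) Minus) i k =
      (\<Sum>j | j < m \<and> i \<le> j. if j = k then 1 else 0)"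
    using Suc by (auto intro!: sum.cong)
  also have "\<dots> = (if i = k then 1 else 0)" using Suc.prems by (auto simp: sum.delta)
  finally show ?case .
qed auto

lemma closed_walks_replicate_Minus: "closed_walks m (replicate n Minus) = m"
  by (simp add: closed_walks_def walks_replicate_Minus)

lemma closed_walks_single: "closed_walks m [a] = m"
proof -
  have "allowed a i i" for i by (cases a) auto
  then show ?thesis by (simp add: closed_walks_def)
qed

section \<open>Lists of distinct labels\<close>

definition distinct_lists :: "'a set \<Rightarrow> nat \<Rightarrow> 'a list set" where
  "distinct_lists Q k = {l. distinct l \<and> length l = k \<and> set l \<subseteq> Q}"

lemma finite_distinct_lists: "finite Q \<Longrightarrow> finite (distinct_lists Q k)"
  by (rule finite_subset[OF _ finite_lists_length_eq[of Q k]]) (auto simp: distinct_lists_def)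

lemma sum_distinct_lists_Suc:
  assumes "finite Q"
  shows "(\<Sum>l\<in>distinct_lists Q (Suc k). F l) = (\<Sum>u\<in>Q. \<Sum>l\<in>distinct_lists (Q - {u}) k. F (u # l))"
proof -
  have "(\<Sum>u\<in>Q. \<Sum>l\<in>distinct_lists (Q - {u}) k. F (u # l)) =
      (\<Sum>(u, l)\<in>Sigma Q (\<lambda>u. distinct_lists (Q - {u}) k). F (u # l))"
    using assms by (intro sum.Sigma) (auto intro: finite_distinct_lists)
  also have "\<dots> = (\<Sum>l\<in>distinct_lists Q (Suc k). F l)"
    by (rule sum.reindex_bij_witness[where i = "\<lambda>l. (hd l, tl l)" and j = "\<lambda>(u, l). u # l"])
      (auto simp: distinct_lists_def length_Suc_conv)
  finally show ?thesis ..
qed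

text \<open>
  The first entry of a list may be chosen last, from the points that the rest has not used.
\<close>
lemma sum_distinct_lists_swap:
  assumes "finite Q"
  shows "(\<Sum>u\<in>Q. \<Sum>l\<in>distinct_lists (Q - {u}) k. F u l) =
         (\<Sum>l\<in>distinct_lists Q k. \<Sum>u\<in>Q - set l. F u l)"
proof -
  have "(\<Sum>u\<in>Q. \<Sum>l\<in>distinct_lists (Q - {u}) k. F u l) =
      (\<Sum>u\<in>Q. \<Sum>l | l \<in> distinct_lists Q k \<and> u \<notin> set l. F u l)"
    by (intro sum.cong) (auto simp: distinct_lists_def)
  also have "\<dots> = (\<Sum>l\<in>distinct_lists Q k. \<Sum>u | u \<in> Q \<and> u \<notin> set l. F u l)"
    using assms by (intro sum.swap_restrict) (auto intro: finite_distinct_lists)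
  also have "\<dots> = (\<Sum>l\<in>distinct_lists Q k. \<Sum>u\<in>Q - set l. F u l)"
    by (intro sum.cong) auto
  finally show ?thesis .
qed

lemma card_Diff_distinct_lists:
  assumes "finite Q" "l \<in> distinct_lists Q k"
  shows "card (Q - set l) = card Q - k"
  using assms by (subst card_Diff_subset) (auto simp: distinct_lists_def distinct_card)

lemma card_distinct_lists_Suc:
  assumes "finite Q"
  shows "card (distinct_lists Q (Suc k)) = card (distinct_lists Q k) * (card Q - k)"
proof -
  have "card (distinct_lists Q (Suc k)) = (\<Sum>l\<in>distinct_lists Q (Suc k). 1)" by simp
  also have "\<dots> = (\<Sum>l\<in>distinct_lists Q k. \<Sum>u\<in>Q - set l. 1)"
    unfolding sum_distinct_lists_Suc[OF assms] sum_distinct_lists_swap[OF assms] ..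
  finally show ?thesis using card_Diff_distinct_lists[OF assms] by simp
qed

section \<open>The path theorem\<close>

definition below :: "nat set \<Rightarrow> nat \<Rightarrow> nat" where
  "below Z x = card {z \<in> Z. z < x}"

lemma below_less:
  assumes "finite Z" "u \<in> Z" "u < x"
  shows "below Z u < below Z x"
  unfolding below_def using assms by (intro psubset_card_mono) auto

lemma below_mono: "finite Z \<Longrightarrow> x \<le> y \<Longrightarrow> below Z x \<le> below Z y"
  unfolding below_def by (intro card_mono) auto

lemma bij_below:
  assumes "finite Z"
  shows "bij_betw (below Z) Z {..<card Z}"
proof -
  have "inj_on (below Z) Z"
    using below_less[OF assms] by (metis inj_onI less_irrefl nat_neq_iff)
  moreover have "below Z ` Z \<subseteq> {..<card Z}"
    unfolding below_def using assms by (auto intro!: psubset_card_mono)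
  ultimately show ?thesis
    by (metis bij_betw_def card_image card_lessThan card_subset_eq finite_lessThan)
qed

lemma sum_below:
  assumes "finite Z"
  shows "(\<Sum>u\<in>Z. g (below Z u)) = (\<Sum>j<card Z. g j)"
  using sum.reindex_bij_betw[OF bij_below[OF assms]] .

lemma bij_below_parts:
  assumes "finite Z" "x \<notin> Z"
  shows "bij_betw (below Z) {u\<in>Z. u < x} {..<below Z x}"
    and "bij_betw (below Z) {u\<in>Z. x < u} {below Z x..<card Z}"
proof -
  have inj: "inj_on (below Z) A" if "A \<subseteq> Z" for A
    using bij_below[OF assms(1)] that by (meson bij_betw_imp_inj_on inj_on_subset)
  have img: "below Z ` Z = {..<card Z}"
    using bij_below[OF assms(1)] by (simp add: bij_betw_def)
  have less: "below Z u < below Z x \<longleftrightarrow> u < x" if "u \<in> Z" for u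
    using below_less[OF assms(1) that] below_mono[OF assms(1), of x u] by (metis linorder_not_le)
  have le: "below Z x \<le> card Z" unfolding below_def using assms by (intro card_mono) auto
  have ne: "u < x \<or> x < u" if "u \<in> Z" for u using that assms by (metis linorder_neqE_nat)
  have "below Z ` {u\<in>Z. u < x} = {j \<in> below Z ` Z. j < below Z x}" using less by auto
  then show "bij_betw (below Z) {u\<in>Z. u < x} {..<below Z x}"
    using inj le img by (auto simp: bij_betw_def)
  have "below Z ` {u\<in>Z. x < u} = {j \<in> below Z ` Z. \<not> j < below Z x}"
    using less ne by (auto simp: not_less) (metis image_eqI less_asym mem_Collect_eq not_less)+
  then show "bij_betw (below Z) {u\<in>Z. x < u} {below Z x..<card Z}"
    using inj img by (auto simp: bij_betw_def)
qed

text \<open>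
  Here \<open>Z\<close> consists of the \<open>m - 1\<close> walls and of the next label \<open>u\<close>, and any of the \<open>m\<close> points may
  be that label. For \<open>a = Minus\<close>, let \<open>k\<close> points lie below \<open>x\<close>. The labels above \<open>x\<close> are new
  roots, of ranks \<open>k, \<dots>, m - 1\<close>, and the \<open>k\<close> labels below \<open>x\<close> keep \<open>x\<close> in cell \<open>k - 1\<close>, so the left
  side is \<open>m (g k + \<dots> + g (m - 1)) + k g (k - 1)\<close>. On the right a label above \<open>x\<close> leaves \<open>x\<close> in cell
  \<open>k\<close> and contributes \<open>g k + \<dots> + g (m - 1)\<close>; each of the \<open>k\<close> labels below contributes \<open>g (k - 1)\<close> in
  addition. The case \<open>a = Plus\<close> is the mirror image.
\<close>
lemma wall_exchange:
  fixes g :: "nat \<Rightarrow> nat"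
  assumes "finite Z" "x \<notin> Z" "card Z = m"
  shows "(\<Sum>u\<in>Z. if root_step a x u = u then m * g (below (Z - {u}) u)
                   else g (below (Z - {u}) x)) =
         (\<Sum>u\<in>Z. \<Sum>j | j < m \<and> allowed a (below (Z - {u}) x) j. g j)"
proof -
  let ?L = "{u\<in>Z. u < x}" and ?H = "{u\<in>Z. x < u}"
  define k where "k = below Z x"
  have fin: "finite ?L" "finite ?H" using assms by auto
  have Z: "Z = ?L \<union> ?H" and disj: "?L \<inter> ?H = {}"
    using assms by (auto, metis linorder_neqE_nat)
  have L: "card ?L = k" by (simp add: k_def below_def)
  have "card Z = card ?L + card ?H" using card_Un_disjoint[OF fin disj] Z by simp
  then have H: "card ?H = m - k" and km: "k \<le> m" using L assms by auto
  have split: "(\<Sum>u\<in>Z. h u) = (\<Sum>u\<in>?L. h u) + (\<Sum>u\<in>?H. h u)" for h :: "nat \<Rightarrow> nat"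
    using sum.union_disjoint[OF fin disj, of h] Z by simp
  have self: "below (Z - {u}) u = below Z u" for u
    unfolding below_def by (rule arg_cong[where f = card]) auto
  have inL: "below (Z - {u}) x = k - 1" if "u \<in> ?L" for u
  proof -
    have "{z \<in> Z - {u}. z < x} = ?L - {u}" by auto
    then show ?thesis using that L by (simp add: below_def)
  qed
  have inH: "below (Z - {u}) x = k" if "u \<in> ?H" for u
    unfolding k_def below_def using that by (intro arg_cong[where f = card]) auto
  have gL: "(\<Sum>u\<in>?L. g (below Z u)) = (\<Sum>j<k. g j)"
    and gH: "(\<Sum>u\<in>?H. g (below Z u)) = (\<Sum>j=k..<m. g j)"
    using sum.reindex_bij_betw[OF bij_below_parts(1)[OF assms(1,2)]]
      sum.reindex_bij_betw[OF bij_below_parts(2)[OF assms(1,2)]] assms(3) by (auto simp: k_def)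
  define G where "G i = (\<Sum>j | j < m \<and> allowed a i j. g j)" for i
  have rhs: "(\<Sum>u\<in>Z. G (below (Z - {u}) x)) = k * G (k - 1) + (m - k) * G k"
    unfolding split using inL inH L H by simp
  show ?thesis
  proof (cases a)
    case Minus
    have Gk: "G i = (\<Sum>j=i..<m. g j)" for i
      unfolding G_def using Minus by (intro sum.cong) auto
    have "k * G (k - 1) = k * g (k - 1) + k * G k"
    proof (cases k)
      case (Suc k')
      then have "G k' = g k' + G k" unfolding Gk using km by (simp add: sum.atLeast_Suc_lessThan)
      then show ?thesis using Suc by (simp add: algebra_simps)
    qed auto
    then have r: "(\<Sum>u\<in>Z. G (below (Z - {u}) x)) = k * g (k - 1) + m * G k"
      using km unfolding rhs by (simp add: add_mult_distrib flip: add.assoc)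
        (metis add_mult_distrib le_add_diff_inverse add.assoc)
    have "(\<Sum>u\<in>Z. if root_step a x u = u then m * g (below (Z - {u}) u)
                   else g (below (Z - {u}) x)) =
       (\<Sum>u\<in>?L. g (below (Z - {u}) x)) + (\<Sum>u\<in>?H. m * g (below Z u))"
      unfolding split using Minus self by (intro arg_cong2[where f = "(+)"] sum.cong) auto
    also have "\<dots> = k * g (k - 1) + m * G k"
      using inL L by (simp add: Gk gH flip: sum_distrib_left)
    finally show ?thesis using r unfolding G_def by simp
  next
    case Plus
    have Gk: "(m - k) * G k = (m - k) * ((\<Sum>j<k. g j) + g k)"
    proof (cases "k < m")
      case True
      then have "{j. j < m \<and> allowed a k j} = {..<Suc k}" using Plus by auto
      then show ?thesis unfolding G_def by simp
    qed auto
    have Gk': "k * G (k - 1) = k * (\<Sum>j<k. g j)"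
    proof (cases k)
      case (Suc k')
      then have "{j. j < m \<and> allowed a k' j} = {..<k}" using Plus km by auto
      then show ?thesis unfolding G_def using Suc by simp
    qed auto
    have r: "(\<Sum>u\<in>Z. G (below (Z - {u}) x)) = m * (\<Sum>j<k. g j) + (m - k) * g k"
      using km unfolding rhs Gk Gk'
      by (simp add: add_mult_distrib2 flip: add.assoc) (metis add_mult_distrib le_add_diff_inverse)
    have "(\<Sum>u\<in>Z. if root_step a x u = u then m * g (below (Z - {u}) u)
                   else g (below (Z - {u}) x)) =
       (\<Sum>u\<in>?L. m * g (below Z u)) + (\<Sum>u\<in>?H. g (below (Z - {u}) x))"
      unfolding split using Plus self by (intro arg_cong2[where f = "(+)"] sum.cong) auto
    also have "\<dots> = m * (\<Sum>j<k. g j) + (m - k) * g k"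
      using inH H by (simp add: gL flip: sum_distrib_left)
    finally show ?thesis using r unfolding G_def by simp
  qed
qed

text \<open>
  On the left, labels are chosen from \<open>Q\<close> and each new root has weight \<open>m\<close>; on the right,
  walks start in the cell of \<open>x\<close> between the \<open>m - 1\<close> points of \<open>Q\<close> that are not labels. In the
  induction step, the first label is chosen after all others, and \<open>wall_exchange\<close> applies to it and
  the walls.
\<close>
lemma sum_root_count_walls:
  assumes "finite Q" "card Q + 1 = length w + m" "1 \<le> m" "x \<notin> Q"
  shows "(\<Sum>l\<in>distinct_lists Q (length w). m ^ root_count w l x) =
         (\<Sum>l\<in>distinct_lists Q (length w). walks_from m w (below (Q - set l) x))"
  using assms
proof (induction w arbitrary: Q x)
  case Nil
  have "distinct_lists Q 0 = {[]}" by (auto simp: distinct_lists_def)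
  moreover have "below Q x < m"
    using Nil unfolding below_def by (auto simp: less_Suc_eq_le intro!: card_mono)
  ultimately show ?case by (simp add: walks_from_def)
next
  case (Cons a w)
  let ?k = "length w"
  have inner: "(\<Sum>l\<in>distinct_lists (Q - {u}) ?k. m ^ root_count (a # w) (u # l) x) =
      (\<Sum>l\<in>distinct_lists (Q - {u}) ?k.
         if root_step a x u = u then m * walks_from m w (below (Q - set l - {u}) u)
         else walks_from m w (below (Q - set l - {u}) x))" if "u \<in> Q" for u
  proof -
    have IH: "(\<Sum>l\<in>distinct_lists (Q - {u}) ?k. m ^ root_count w l y) =
      (\<Sum>l\<in>distinct_lists (Q - {u}) ?k. walks_from m w (below (Q - set l - {u}) y))"
      if "y \<notin> Q - {u}" for y
    proof -
      have "card (Q - {u}) + 1 = length w + m" using Cons.prems \<open>u \<in> Q\<close> by simp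
      moreover have "Q - {u} - set l = Q - set l - {u}" for l by auto
      ultimately show ?thesis using Cons.IH[of "Q - {u}" y] that Cons.prems by simp
    qed
    show ?thesis
    proof (cases "root_step a x u = u")
      case True
      then show ?thesis using IH[of u] by (simp flip: sum_distrib_left)
    next
      case False
      then have "root_step a x u = x" by (cases a) (auto simp: max_def min_def split: if_splits)
      then show ?thesis using False IH[of x] Cons.prems by simp
    qed
  qed
  have "(\<Sum>l\<in>distinct_lists Q (length (a # w)). m ^ root_count (a # w) l x) =
     (\<Sum>u\<in>Q. \<Sum>l\<in>distinct_lists (Q - {u}) ?k.
         if root_step a x u = u then m * walks_from m w (below (Q - set l - {u}) u)
         else walks_from m w (below (Q - set l - {u}) x))"
    using inner by (simp add: sum_distinct_lists_Suc[OF Cons.prems(1)] cong: sum.cong del: root_count.simps)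
  also have "\<dots> = (\<Sum>l\<in>distinct_lists Q ?k. \<Sum>u\<in>Q - set l.
         if root_step a x u = u then m * walks_from m w (below (Q - set l - {u}) u)
         else walks_from m w (below (Q - set l - {u}) x))"
    by (rule sum_distinct_lists_swap) (fact Cons.prems)
  also have "\<dots> = (\<Sum>l\<in>distinct_lists Q ?k. \<Sum>u\<in>Q - set l.
         walks_from m (a # w) (below (Q - set l - {u}) x))"
  proof (rule sum.cong)
    fix l assume "l \<in> distinct_lists Q ?k"
    then have "card (Q - set l) = m" using Cons.prems by (simp add: card_Diff_distinct_lists)
    then show "(\<Sum>u\<in>Q - set l.
         if root_step a x u = u then m * walks_from m w (below (Q - set l - {u}) u)
         else walks_from m w (below (Q - set l - {u}) x)) = (\<Sum>u\<in>Q - set l.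
         walks_from m (a # w) (below (Q - set l - {u}) x))"
      unfolding walks_from_Cons using Cons.prems by (intro wall_exchange) auto
  qed simp
  also have "\<dots> = (\<Sum>l\<in>distinct_lists Q (length (a # w)).
      walks_from m (a # w) (below (Q - set l) x))"
    unfolding length_Cons sum_distinct_lists_Suc[OF Cons.prems(1)]
      sum_distinct_lists_swap[OF Cons.prems(1), symmetric]
    by (simp add: Diff_insert[of Q _ "set _"])
  finally show ?case .
qed

text \<open>
  The first vertex is always a root. Given the other labels, its label \<open>u\<close> and
  the walls form a set of \<open>m\<close> points in which \<open>u\<close> takes every rank once, so the walk starts
  once in every cell.
\<close>
lemma sum_root_count_path:
  assumes "finite Q" "card Q = length w + m" "1 \<le> m"
  shows "(\<Sum>u\<in>Q. \<Sum>l\<in>distinct_lists (Q - {u}) (length w). m ^ (1 + root_count w l u)) =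
         card (distinct_lists Q (Suc (length w))) * (\<Sum>i<m. walks_from m w i)"
proof -
  let ?k = "length w"
  have "(\<Sum>u\<in>Q. \<Sum>l\<in>distinct_lists (Q - {u}) ?k. m ^ (1 + root_count w l u)) =
      (\<Sum>u\<in>Q. \<Sum>l\<in>distinct_lists (Q - {u}) ?k. m * walks_from m w (below (Q - set l) u))"
  proof (rule sum.cong)
    fix u assume u: "u \<in> Q"
    have "below (Q - {u} - set l) u = below (Q - set l) u" for l
      unfolding below_def by (rule arg_cong[where f = card]) auto
    then show "(\<Sum>l\<in>distinct_lists (Q - {u}) ?k. m ^ (1 + root_count w l u)) =
      (\<Sum>l\<in>distinct_lists (Q - {u}) ?k. m * walks_from m w (below (Q - set l) u))"
      using sum_root_count_walls[of "Q - {u}" w m u] assms u by (simp flip: sum_distrib_left)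
  qed simp
  also have "\<dots> = (\<Sum>l\<in>distinct_lists Q ?k. \<Sum>u\<in>Q - set l. m * walks_from m w (below (Q - set l) u))"
    by (rule sum_distinct_lists_swap) (fact assms)
  also have "\<dots> = (\<Sum>l\<in>distinct_lists Q ?k. m * (\<Sum>i<m. walks_from m w i))"
  proof (rule sum.cong)
    fix l assume "l \<in> distinct_lists Q ?k"
    then have "card (Q - set l) = m" using assms by (simp add: card_Diff_distinct_lists)
    then show "(\<Sum>u\<in>Q - set l. m * walks_from m w (below (Q - set l) u)) =
        m * (\<Sum>i<m. walks_from m w i)"
      using sum_below[of "Q - set l" "walks_from m w"] assms(1) by (simp flip: sum_distrib_left)
  qed simp
  also have "\<dots> = card (distinct_lists Q (Suc ?k)) * (\<Sum>i<m. walks_from m w i)"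
    using assms by (simp add: card_distinct_lists_Suc)
  finally show ?thesis .
qed

section \<open>The cyclic theorem\<close>

text \<open>
  The final identity at \<open>t = m\<close>, averaged over all choices of labels out of a set \<open>Q\<close> with
  room for \<open>m - 1\<close> walls. In this form the contraction, which removes one label from both \<open>Q\<close> and the
  word, is again an instance.
\<close>
definition cyc_identity :: "nat \<Rightarrow> sign list \<Rightarrow> bool" where
  "cyc_identity m w \<longleftrightarrow> (\<forall>Q. finite Q \<longrightarrow> card Q + 1 = length w + m \<longrightarrow>
     (\<Sum>l\<in>distinct_lists Q (length w). m ^ cyc_roots w l) =
     card (distinct_lists Q (length w)) * closed_walks m w)"

text \<open>
  By \<open>flip_root_count\<close> and \<open>flip_closed_walks\<close>, the identities for the two signs add up to
  \<open>sum_root_count_path\<close> plus the identity for the contraction \<open>w\<close>.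
\<close>
lemma cyc_identity_flip:
  assumes "1 \<le> m" "w \<noteq> []" "cyc_identity m w"
  shows "cyc_identity m (Minus # w) \<longleftrightarrow> cyc_identity m (Plus # w)"
proof -
  let ?k = "length w"
  have *: "(\<Sum>l\<in>distinct_lists Q (Suc ?k). m ^ cyc_roots (Minus # w) l) +
      (\<Sum>l\<in>distinct_lists Q (Suc ?k). m ^ cyc_roots (Plus # w) l) =
      card (distinct_lists Q (Suc ?k)) * (closed_walks m (Minus # w) + closed_walks m (Plus # w))"
    if Q: "finite Q" "card Q + 1 = Suc ?k + m" for Q
  proof -
    have "(\<Sum>l\<in>distinct_lists Q (Suc ?k). m ^ cyc_roots (Minus # w) l) +
      (\<Sum>l\<in>distinct_lists Q (Suc ?k). m ^ cyc_roots (Plus # w) l) =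
      (\<Sum>u\<in>Q. \<Sum>l\<in>distinct_lists (Q - {u}) ?k.
         m ^ cyc_roots (Minus # w) (u # l) + m ^ cyc_roots (Plus # w) (u # l))"
      by (simp add: sum_distinct_lists_Suc[OF Q(1)] sum.distrib)
    also have "\<dots> = (\<Sum>u\<in>Q. \<Sum>l\<in>distinct_lists (Q - {u}) ?k.
         m ^ (1 + root_count w l u) + m ^ cyc_roots w l)"
      using assms(2) by (intro sum.cong flip_root_count refl) (auto simp: distinct_lists_def)
    also have "\<dots> = (\<Sum>u\<in>Q. \<Sum>l\<in>distinct_lists (Q - {u}) ?k. m ^ (1 + root_count w l u)) +
       (\<Sum>u\<in>Q. \<Sum>l\<in>distinct_lists (Q - {u}) ?k. m ^ cyc_roots w l)"
      by (simp add: sum.distrib)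
    also have "(\<Sum>u\<in>Q. \<Sum>l\<in>distinct_lists (Q - {u}) ?k. m ^ cyc_roots w l) =
       (\<Sum>u\<in>Q. \<Sum>l\<in>distinct_lists (Q - {u}) ?k. closed_walks m w)"
    proof (rule sum.cong)
      fix u assume "u \<in> Q"
      then have "finite (Q - {u})" "card (Q - {u}) + 1 = ?k + m"
        using Q card_Suc_Diff1[of Q u] by auto
      then show "(\<Sum>l\<in>distinct_lists (Q - {u}) ?k. m ^ cyc_roots w l) =
          (\<Sum>l\<in>distinct_lists (Q - {u}) ?k. closed_walks m w)"
        using assms(3) unfolding cyc_identity_def by simp
    qed simp
    also have "\<dots> = card (distinct_lists Q (Suc ?k)) * closed_walks m w"
      using sum_distinct_lists_Suc[OF Q(1), of "\<lambda>_. closed_walks m w" ?k] by simp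
    also have "(\<Sum>u\<in>Q. \<Sum>l\<in>distinct_lists (Q - {u}) ?k. m ^ (1 + root_count w l u)) =
       card (distinct_lists Q (Suc ?k)) * (\<Sum>i<m. walks_from m w i)"
      using Q assms(1) by (intro sum_root_count_path) auto
    finally show ?thesis unfolding flip_closed_walks by (simp add: distrib_left)
  qed
  show ?thesis
    unfolding cyc_identity_def length_Cons
  proof (intro all_cong1 imp_cong refl)
    fix Q :: "nat set" assume "finite Q" "card Q + 1 = Suc ?k + m"
    from *[OF this] show "((\<Sum>l\<in>distinct_lists Q (Suc ?k). m ^ cyc_roots (Minus # w) l) =
        card (distinct_lists Q (Suc ?k)) * closed_walks m (Minus # w)) =
      ((\<Sum>l\<in>distinct_lists Q (Suc ?k). m ^ cyc_roots (Plus # w) l) =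
        card (distinct_lists Q (Suc ?k)) * closed_walks m (Plus # w))"
      unfolding distrib_left by linarith
  qed
qed

lemma cyc_identity_rotate: "cyc_identity m (w @ [a]) \<longleftrightarrow> cyc_identity m (a # w)"
proof -
  have "(\<Sum>l\<in>distinct_lists Q (Suc (length w)). m ^ cyc_roots (a # w) l) =
      (\<Sum>l\<in>distinct_lists Q (Suc (length w)). m ^ cyc_roots (w @ [a]) l)" for Q
  proof (rule sum.reindex_bij_witness[where j = rotate1 and i = "\<lambda>l. last l # butlast l"])
    fix l assume "l \<in> distinct_lists Q (Suc (length w))"
    then obtain u l' where "l = u # l'" "length w = length l'" "distinct l"
      by (auto simp: distinct_lists_def length_Suc_conv)
    then show "m ^ cyc_roots (w @ [a]) (rotate1 l) = m ^ cyc_roots (a # w) l"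
      by (simp add: cyc_roots_rotate)
  next
    fix l assume l: "l \<in> distinct_lists Q (Suc (length w))"
    then show "last (rotate1 l) # butlast (rotate1 l) = l"
      by (auto simp: distinct_lists_def length_Suc_conv)
    show "rotate1 l \<in> distinct_lists Q (Suc (length w))" using l by (simp add: distinct_lists_def)
    obtain l' u where "l = l' @ [u]" using l by (cases l rule: rev_cases) (auto simp: distinct_lists_def)
    then show "rotate1 (last l # butlast l) = l" "last l # butlast l \<in> distinct_lists Q (Suc (length w))"
      using l by (auto simp: distinct_lists_def)
  qed
  then show ?thesis unfolding cyc_identity_def by (simp add: closed_walks_rotate)
qed

lemma cyc_identity_replicate:
  assumes "n > 0"
  shows "cyc_identity m (replicate n Minus)"
proof -
  have "cyc_roots (replicate n Minus) l = 1" if "l \<in> distinct_lists Q n" for l Q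
    using cyc_roots_replicate_Minus[of l] that assms by (auto simp: distinct_lists_def)
  then show ?thesis unfolding cyc_identity_def by (simp add: closed_walks_replicate_Minus)
qed

text \<open>
  Induction on the length, which supplies the contractions. Since only the sign at the head can be
  flipped, the word is rotated after each flip, so that every sign gets its turn.
\<close>
lemma cyc_identity:
  assumes "1 \<le> m" "w \<noteq> []"
  shows "cyc_identity m w"
  using assms(2)
proof (induction "length w" arbitrary: w)
  case (Suc k)
  show ?case
  proof (cases "k = 0")
    \<comment> \<open>A single vertex would be contracted to the empty cycle, which has no labels to start a run at.\<close>
    case True
    then obtain a where a: "w = [a]" using Suc(2) by (cases w) auto
    have "cyc_roots [a] l = 1" if "l \<in> distinct_lists Q (Suc 0)" for l Q
      using that cyc_roots_single by (auto simp: distinct_lists_def length_Suc_conv)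
    then show ?thesis unfolding a cyc_identity_def by (simp add: closed_walks_single)
  next
    case False
    have flip: "cyc_identity m (a # v) \<longleftrightarrow> cyc_identity m (Minus # v)" if "length v = k" for a v
    proof -
      have "v \<noteq> []" using that False by auto
      then show ?thesis using cyc_identity_flip[OF assms(1), of v] Suc(1)[of v] that
        by (cases a) auto
    qed
    \<comment> \<open>Each sign of \<open>v\<close> in turn is flipped at the head and then rotated to the end of \<open>u\<close>.\<close>
    have "cyc_identity m (v @ u) \<longleftrightarrow> cyc_identity m (replicate (length v) Minus @ u)"
      if "length v + length u = Suc k" for u v
      using that
    proof (induction v arbitrary: u)
      case (Cons a v)
      have "cyc_identity m (a # v @ u) \<longleftrightarrow> cyc_identity m (v @ u @ [Minus])"
        using flip[of "v @ u" a] cyc_identity_rotate[of m "v @ u" Minus] Cons.prems by simp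
      also have "\<dots> \<longleftrightarrow> cyc_identity m (replicate (length v) Minus @ u @ [Minus])"
        using Cons.IH[of "u @ [Minus]"] Cons.prems by simp
      also have "\<dots> \<longleftrightarrow> cyc_identity m (replicate (length (a # v)) Minus @ u)"
        using cyc_identity_rotate[of m "replicate (length v) Minus @ u" Minus] by simp
      finally show ?case by simp
    qed simp
    from this[of w "[]"] show ?thesis
      using Suc.hyps(2)[symmetric] cyc_identity_replicate[of "Suc k" m] by simp
  qed
qed simp

text \<open>
  The statistic depends on the relative order of the labels only.
\<close>
lemma sum_distinct_lists_eq:
  assumes w: "w \<noteq> []" "length w = n" and S: "finite S" "card S = n"
  shows "(\<Sum>l\<in>distinct_lists S n. (t::nat) ^ cyc_roots w l) =
         (\<Sum>l\<in>distinct_lists {..<n} n. t ^ cyc_roots w l)"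
proof -
  obtain f where f: "bij_betw f {..<n} S" "strict_mono_on {..<n} f"
    using ex_bij_betw_strict_mono_card[OF S(1)] S(2) by (metis lessThan_atLeast0)
  have inj: "inj_on f {..<n}" and img: "f ` {..<n} = S" using f(1) by (auto simp: bij_betw_def)
  show ?thesis
  proof (rule sum.reindex_bij_witness[symmetric, where j = "map f" and i = "map (inv_into {..<n} f)"])
    fix l assume l: "l \<in> distinct_lists {..<n} n"
    have sub: "set l \<subseteq> {..<n}" "length w = length l" "l \<noteq> []" "distinct l"
      using l w by (auto simp: distinct_lists_def)
    show "t ^ cyc_roots w (map f l) = t ^ cyc_roots w l"
      using sub f(2) by (subst cyc_roots_map) (auto intro: monotone_on_subset)
    show "map (inv_into {..<n} f) (map f l) = l"
      using sub inj by (auto intro!: map_idI simp: inv_into_f_f subset_iff)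
    show "map f l \<in> distinct_lists S n"
      using sub img inj l by (auto simp: distinct_lists_def distinct_map intro: inj_on_subset)
  next
    fix l assume l: "l \<in> distinct_lists S n"
    then show "map f (map (inv_into {..<n} f) l) = l"
      using img by (auto intro!: map_idI simp: f_inv_into_f distinct_lists_def subset_iff)
    have "inj_on (inv_into {..<n} f) (set l)"
      using l img by (intro inj_on_inv_into) (auto simp: distinct_lists_def)
    then show "map (inv_into {..<n} f) l \<in> distinct_lists {..<n} n"
      using l img inv_into_into[of _ f "{..<n}"] by (auto simp: distinct_lists_def distinct_map subset_iff)
  qed
qed

lemma card_distinct_lists_all:
  assumes "finite S" "card S = n"
  shows "card (distinct_lists S n) = fact n"
proof -
  have "distinct_lists S n = {l. length l = n \<and> distinct l \<and> set l \<subseteq> S}" by (auto simp: distinct_lists_def)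
  then show ?thesis using assms by (simp add: card_lists_distinct_length_eq fact_prod)
qed

text \<open>
  All \<open>n\<close>-subsets of \<open>Q\<close> contribute equally to \<open>cyc_identity\<close>, so their number cancels.
\<close>
lemma sum_cyc_roots:
  assumes "w \<noteq> []" "length w = n" "1 \<le> m"
  shows "(\<Sum>l\<in>distinct_lists {..<n} n. m ^ cyc_roots w l) = fact n * closed_walks m w"
proof -
  define Q where "Q = {..<n + m - 1}"
  define \<T> where "\<T> = {S. S \<subseteq> Q \<and> card S = n}"
  have Q: "finite Q" "card Q + 1 = n + m" using assms by (auto simp: Q_def)
  have fin: "finite \<T>" unfolding \<T>_def using Q by simp
  have finS: "finite S" if "S \<in> \<T>" for S using that Q by (auto simp: \<T>_def intro: finite_subset)
  have ne: "\<T> \<noteq> {}"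
    unfolding \<T>_def Q_def using assms by (auto intro!: exI[of _ "{..<n}"])
  have part: "distinct_lists Q n = (\<Union>S\<in>\<T>. distinct_lists S n)"
    by (auto simp: distinct_lists_def \<T>_def distinct_card)
  have eqset: "set l = S" if "S \<in> \<T>" "l \<in> distinct_lists S n" for l S
    using that finS[of S] distinct_card[of l] card_subset_eq[of S "set l"]
    by (simp add: distinct_lists_def \<T>_def)
  have sum: "(\<Sum>l\<in>distinct_lists Q n. h l) = (\<Sum>S\<in>\<T>. \<Sum>l\<in>distinct_lists S n. h l)" for h :: "nat list \<Rightarrow> nat"
    unfolding part
  proof (rule sum.UNION_disjoint)
    show "\<forall>S\<in>\<T>. \<forall>S'\<in>\<T>. S \<noteq> S' \<longrightarrow> distinct_lists S n \<inter> distinct_lists S' n = {}" using eqset by blast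
  qed (use fin finS in \<open>auto intro: finite_distinct_lists\<close>)
  have "(\<Sum>l\<in>distinct_lists Q n. m ^ cyc_roots w l) = card \<T> * (\<Sum>l\<in>distinct_lists {..<n} n. m ^ cyc_roots w l)"
  proof -
    have "(\<Sum>S\<in>\<T>. \<Sum>l\<in>distinct_lists S n. m ^ cyc_roots w l) =
        (\<Sum>S\<in>\<T>. \<Sum>l\<in>distinct_lists {..<n} n. m ^ cyc_roots w l)"
      by (rule sum.cong[OF refl], rule sum_distinct_lists_eq[OF assms(1,2)])
        (auto simp: finS, simp add: \<T>_def)
    then show ?thesis unfolding sum by simp
  qed
  moreover have "card (distinct_lists Q n) = card \<T> * fact n"
  proof -
    have "card (distinct_lists Q n) = (\<Sum>S\<in>\<T>. card (distinct_lists S n))" using sum[of "\<lambda>_. 1"] by simp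
    also have "\<dots> = card \<T> * fact n"
      using finS by (simp add: \<T>_def card_distinct_lists_all)
    finally show ?thesis .
  qed
  moreover have "(\<Sum>l\<in>distinct_lists Q n. m ^ cyc_roots w l) = card (distinct_lists Q n) * closed_walks m w"
    using cyc_identity[OF assms(3,1)] Q assms(2) by (simp add: cyc_identity_def)
  moreover have "card \<T> > 0" using fin ne by (simp add: card_gt_0_iff)
  ultimately show ?thesis by simp
qed

section \<open>Vertices of the cycle\<close>

lemma next_vertex_eq: "j < length \<delta> \<Longrightarrow> next_vertex \<delta> j = (if Suc j = length \<delta> then 0 else Suc j)"
  by (auto simp: next_vertex_def)

lemma prev_vertex_eq: "j < length \<delta> \<Longrightarrow> prev_vertex \<delta> j = (if j = 0 then length \<delta> - 1 else j - 1)"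
  by (auto simp: prev_vertex_def mod_if)

lemma next_vertex_less: "j < length \<delta> \<Longrightarrow> next_vertex \<delta> j < length \<delta>"
  by (auto simp: next_vertex_eq)

lemma prev_vertex_less: "j < length \<delta> \<Longrightarrow> prev_vertex \<delta> j < length \<delta>"
  by (auto simp: prev_vertex_eq)

lemma prev_next: "j < length \<delta> \<Longrightarrow> prev_vertex \<delta> (next_vertex \<delta> j) = j"
  by (simp add: prev_vertex_eq next_vertex_less) (auto simp: next_vertex_eq)

lemma next_prev: "j < length \<delta> \<Longrightarrow> next_vertex \<delta> (prev_vertex \<delta> j) = j"
  by (simp add: next_vertex_eq prev_vertex_less) (auto simp: prev_vertex_eq)

lemma next_vertex_shift:
  "next_vertex \<delta> ((r + i) mod length \<delta>) = (r + Suc i) mod length \<delta>"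
  by (simp add: next_vertex_def mod_Suc_eq)

lemma vertex_offset:
  assumes "r < length \<delta>" "j < length \<delta>"
  obtains i where "i < length \<delta>" "j = (r + i) mod length \<delta>"
proof (cases "r \<le> j")
  case True
  then show ?thesis using assms that[of "j - r"] by auto
next
  case False
  then show ?thesis using assms that[of "j + length \<delta> - r"] by (auto simp: mod_if)
qed

lemma cycle_induct:
  assumes "r < length \<delta>" "P r"
    and "\<And>j. j < length \<delta> \<Longrightarrow> P j \<Longrightarrow> P (next_vertex \<delta> j)" and "j < length \<delta>"
  shows "P j"
proof -
  have "P ((r + i) mod length \<delta>)" for i
  proof (induction i)
    case (Suc i)
    have "(r + i) mod length \<delta> < length \<delta>" using assms(1) by (intro mod_less_divisor) auto
    from assms(3)[OF this Suc] show ?case unfolding next_vertex_shift .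
  qed (use assms in simp)
  with vertex_offset[OF assms(1,4)] show ?thesis by metis
qed

lemma cycle_induct_prev:
  assumes "r < length \<delta>" "P r"
    and "\<And>j. j < length \<delta> \<Longrightarrow> P j \<Longrightarrow> P (prev_vertex \<delta> j)" and "j < length \<delta>"
  shows "P j"
proof (rule ccontr)
  assume "\<not> P j"
  then have "\<not> P r"
  proof (rule cycle_induct[where P = "\<lambda>j. \<not> P j", OF assms(4) _ _ assms(1)])
    fix i assume "i < length \<delta>" "\<not> P i"
    then show "\<not> P (next_vertex \<delta> i)" using assms(3)[of "next_vertex \<delta> i"]
      by (auto simp: next_vertex_less prev_next)
  qed
  with assms(2) show False by simp
qed

section \<open>Order-preserving maps as closed walks\<close>

lemma order_preserving_maps_fence:
  "order_preserving_maps (vertices \<delta>) (circular_fence \<delta>) m =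
   {f \<in> vertices \<delta> \<rightarrow>\<^sub>E {1..m}. \<forall>j<length \<delta>. allowed (\<delta> ! j) (f j) (f (next_vertex \<delta> j))}"
proof -
  have "(\<forall>(x, y)\<in>circular_fence \<delta>. f x \<le> f y) \<longleftrightarrow>
      (\<forall>j<length \<delta>. allowed (\<delta> ! j) (f j) (f (next_vertex \<delta> j)))" for f :: "nat \<Rightarrow> nat"
  proof
    assume *: "\<forall>(x, y)\<in>circular_fence \<delta>. f x \<le> f y"
    show "\<forall>j<length \<delta>. allowed (\<delta> ! j) (f j) (f (next_vertex \<delta> j))"
    proof (intro allI impI)
      fix j assume j: "j < length \<delta>"
      have step: "f x \<le> f y" if "(x, y) \<in> fence_steps \<delta>" for x y
        using * that by (auto simp: circular_fence_def)
      show "allowed (\<delta> ! j) (f j) (f (next_vertex \<delta> j))"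
        using j by (cases "\<delta> ! j") (auto intro!: step simp: fence_steps_def)
    qed
  next
    assume *: "\<forall>j<length \<delta>. allowed (\<delta> ! j) (f j) (f (next_vertex \<delta> j))"
    have step: "f x \<le> f y" if "(x, y) \<in> fence_steps \<delta>" for x y
      using that * unfolding fence_steps_def by force
    have "f x \<le> f y" if "(x, y) \<in> (fence_steps \<delta>)\<^sup>+" for x y
      using that by (induction rule: trancl_induct) (auto dest: step)
    then show "\<forall>(x, y)\<in>circular_fence \<delta>. f x \<le> f y" by (auto simp: circular_fence_def)
  qed
  then show ?thesis by (simp add: order_preserving_maps_def)
qed

definition walk_lists :: "nat \<Rightarrow> sign list \<Rightarrow> nat \<Rightarrow> nat list set" where
  "walk_lists m w i = {xs. length xs = length w \<and> set xs \<subseteq> {..<m} \<and>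
     (\<forall>j<length w. allowed (w ! j) ((i # xs) ! j) (xs ! j))}"

lemma finite_walk_lists: "finite (walk_lists m w i)"
  by (rule finite_subset[OF _ finite_lists_length_eq[of "{..<m}" "length w"]])
    (auto simp: walk_lists_def)

lemma walks_card: "walks m w i k = card {xs \<in> walk_lists m w i. last (i # xs) = k}"
proof (induction w arbitrary: i)
  case Nil
  have "{xs \<in> walk_lists m [] i. last (i # xs) = k} = (if i = k then {[]} else {})"
    by (auto simp: walk_lists_def)
  then show ?case by simp
next
  case (Cons a w)
  let ?J = "{j. j < m \<and> allowed a i j}"
  let ?W = "\<lambda>j. {xs \<in> walk_lists m w j. last (j # xs) = k}"
  have "{xs \<in> walk_lists m (a # w) i. last (i # xs) = k} = (\<Union>j\<in>?J. (#) j ` ?W j)"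
  proof (intro equalityI subsetI)
    fix xs assume xs: "xs \<in> {xs \<in> walk_lists m (a # w) i. last (i # xs) = k}"
    then obtain j ys where "xs = j # ys" by (cases xs) (auto simp: walk_lists_def)
    with xs have "j \<in> ?J" "ys \<in> ?W j" "xs = j # ys"
      by (auto simp: walk_lists_def All_less_Suc2)
    then show "xs \<in> (\<Union>j\<in>?J. (#) j ` ?W j)" by blast
  qed (auto simp: walk_lists_def All_less_Suc2)
  also have "card \<dots> = (\<Sum>j\<in>?J. card ((#) j ` ?W j))"
    by (rule card_UN_disjoint) (auto simp: finite_walk_lists)
  also have "\<dots> = walks m (a # w) i k"
    using Cons by (simp add: card_image)
  finally show ?case by simp
qed

text \<open>
  A closed walk that starts at \<open>i\<close> ends there, so its list of values \<open>xs\<close> determines it, and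
  \<open>xs ! j\<close> is the value at the vertex after \<open>j\<close>. Values of maps are numbered from 1, those of
  walks from 0.
\<close>
lemma card_order_preserving_maps:
  assumes "\<delta> \<noteq> []"
  shows "card (order_preserving_maps (vertices \<delta>) (circular_fence \<delta>) m) = closed_walks m \<delta>"
proof -
  let ?n = "length \<delta>"
  define X where "X = {xs. length xs = ?n \<and> set xs \<subseteq> {..<m} \<and>
     (\<forall>j<?n. allowed (\<delta> ! j) (xs ! prev_vertex \<delta> j) (xs ! j))}"
  \<comment> \<open>Putting the last value in front makes the list of a closed walk cyclic.\<close>
  have nth: "(last xs # xs) ! j = xs ! prev_vertex \<delta> j" if "length xs = ?n" "j < ?n" for xs j
  proof -
    have "xs \<noteq> []" using that by auto
    then show ?thesis using that by (cases j) (auto simp: prev_vertex_eq last_conv_nth)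
  qed
  have X: "X = (\<Union>i<m. {xs \<in> walk_lists m \<delta> i. last (i # xs) = i})"
  proof (intro equalityI subsetI)
    fix xs assume xs: "xs \<in> X"
    then have "xs \<noteq> []" using assms by (auto simp: X_def)
    then have "last xs \<in> set xs" by simp
    then have "last xs < m" using xs by (auto simp: X_def)
    moreover have "xs \<in> walk_lists m \<delta> (last xs)"
      using xs nth[of xs] by (auto simp: X_def walk_lists_def)
    ultimately show "xs \<in> (\<Union>i<m. {xs \<in> walk_lists m \<delta> i. last (i # xs) = i})"
      using \<open>xs \<noteq> []\<close> by auto
  next
    fix xs assume "xs \<in> (\<Union>i<m. {xs \<in> walk_lists m \<delta> i. last (i # xs) = i})"
    then have "xs \<in> walk_lists m \<delta> (last xs)"
      using assms by (auto simp: walk_lists_def split: if_splits)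
    then show "xs \<in> X" using nth[of xs] by (auto simp: X_def walk_lists_def)
  qed
  have "card X = (\<Sum>i<m. card {xs \<in> walk_lists m \<delta> i. last (i # xs) = i})"
    unfolding X
  proof (rule card_UN_disjoint)
    show "\<forall>i\<in>{..<m}. finite {xs \<in> walk_lists m \<delta> i. last (i # xs) = i}"
      by (simp add: finite_walk_lists)
  qed (use assms in \<open>auto simp: walk_lists_def split: if_splits\<close>)
  then have card: "card X = closed_walks m \<delta>" by (simp add: closed_walks_def walks_card)
  have suc: "allowed a (Suc x) (Suc y) \<longleftrightarrow> allowed a x y" for a x y by (cases a) auto
  have pred: "allowed a (x - 1) (y - 1) \<longleftrightarrow> allowed a x y" if "1 \<le> x" "1 \<le> y" for a x y
    using that by (cases a) auto
  have "bij_betw (\<lambda>xs. \<lambda>v\<in>vertices \<delta>. Suc (xs ! prev_vertex \<delta> v)) X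
      (order_preserving_maps (vertices \<delta>) (circular_fence \<delta>) m)"
  proof (rule bij_betw_byWitness[where f' = "\<lambda>f. map (\<lambda>j. f (next_vertex \<delta> j) - 1) [0..<?n]"])
    show "\<forall>xs\<in>X. map (\<lambda>j. (\<lambda>v\<in>vertices \<delta>. Suc (xs ! prev_vertex \<delta> v)) (next_vertex \<delta> j) - 1)
        [0..<?n] = xs"
      by (auto simp: X_def next_vertex_less prev_next intro!: nth_equalityI)
    show "\<forall>f\<in>order_preserving_maps (vertices \<delta>) (circular_fence \<delta>) m.
       (\<lambda>v\<in>vertices \<delta>. Suc (map (\<lambda>j. f (next_vertex \<delta> j) - 1) [0..<?n] ! prev_vertex \<delta> v)) = f"
    proof
      fix f assume "f \<in> order_preserving_maps (vertices \<delta>) (circular_fence \<delta>) m"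
      then have f: "f \<in> vertices \<delta> \<rightarrow>\<^sub>E {1..m}" by (simp add: order_preserving_maps_def)
      show "(\<lambda>v\<in>vertices \<delta>. Suc (map (\<lambda>j. f (next_vertex \<delta> j) - 1) [0..<?n] ! prev_vertex \<delta> v)) = f"
      proof (rule ext)
        fix v
        show "(\<lambda>v\<in>vertices \<delta>.
            Suc (map (\<lambda>j. f (next_vertex \<delta> j) - 1) [0..<?n] ! prev_vertex \<delta> v)) v = f v"
        proof (cases "v < ?n")
          case True
          then have "1 \<le> f v" using PiE_mem[OF f, of v] by simp
          then show ?thesis using True by (simp add: prev_vertex_less next_prev)
        next
          case False
          then show ?thesis using PiE_arb[OF f, of v] by simp
        qed
      qed
    qed
    show "(\<lambda>xs. \<lambda>v\<in>vertices \<delta>. Suc (xs ! prev_vertex \<delta> v)) ` X \<subseteq>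
        order_preserving_maps (vertices \<delta>) (circular_fence \<delta>) m"
    proof (rule image_subsetI)
      fix xs assume xs: "xs \<in> X"
      let ?f = "\<lambda>v\<in>vertices \<delta>. Suc (xs ! prev_vertex \<delta> v)"
      have lt: "xs ! prev_vertex \<delta> v < m" if "v < ?n" for v
      proof -
        have "length xs = ?n" "set xs \<subseteq> {..<m}" using xs by (simp_all add: X_def)
        then have "xs ! prev_vertex \<delta> v \<in> {..<m}"
          using prev_vertex_less[OF that] by (intro subsetD[OF _ nth_mem]) simp_all
        then show ?thesis by simp
      qed
      have "?f \<in> vertices \<delta> \<rightarrow>\<^sub>E {1..m}" using lt by (simp add: restrict_PiE_iff Suc_le_eq)
      moreover have "allowed (\<delta> ! j) (?f j) (?f (next_vertex \<delta> j))" if j: "j < ?n" for j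
      proof -
        have "?f j = Suc (xs ! prev_vertex \<delta> j)" "?f (next_vertex \<delta> j) = Suc (xs ! j)"
          using j next_vertex_less[OF j] prev_next[OF j] by simp_all
        moreover have "allowed (\<delta> ! j) (xs ! prev_vertex \<delta> j) (xs ! j)"
          using xs j by (simp add: X_def)
        ultimately show ?thesis by (simp only: suc)
      qed
      ultimately show "?f \<in> order_preserving_maps (vertices \<delta>) (circular_fence \<delta>) m"
        unfolding order_preserving_maps_fence by blast
    qed
    show "(\<lambda>f. map (\<lambda>j. f (next_vertex \<delta> j) - 1) [0..<?n]) `
        order_preserving_maps (vertices \<delta>) (circular_fence \<delta>) m \<subseteq> X"
    proof (clarify)
      fix f assume "f \<in> order_preserving_maps (vertices \<delta>) (circular_fence \<delta>) m"
      then have f: "f \<in> vertices \<delta> \<rightarrow>\<^sub>E {1..m}"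
        and a: "\<And>j. j < ?n \<Longrightarrow> allowed (\<delta> ! j) (f j) (f (next_vertex \<delta> j))"
        by (auto simp: order_preserving_maps_fence)
      have r: "1 \<le> f v \<and> f v \<le> m" if "v < ?n" for v using PiE_mem[OF f, of v] that by simp
      have lt: "f (next_vertex \<delta> j) - 1 < m" if "j < ?n" for j
        using r[OF next_vertex_less[OF that]] by linarith
      have al: "allowed (\<delta> ! j) (f j - 1) (f (next_vertex \<delta> j) - 1)" if "j < ?n" for j
        using a[OF that] r[OF that] r[OF next_vertex_less[OF that]] pred by blast
      show "map (\<lambda>j. f (next_vertex \<delta> j) - 1) [0..<?n] \<in> X"
        unfolding X_def using lt al by (auto simp: prev_vertex_less next_prev)
    qed
  qed
  then show ?thesis using card bij_betw_same_card by metis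
qed

section \<open>Trajectories\<close>

text \<open>
  The letter \<open>\<delta> ! j\<close> belongs to the edge from \<open>j\<close> to its successor and thus decides whether the
  successor is an ascent vertex. Shifting the labels by one pairs each letter with the vertex that it
  governs, and \<open>run \<delta> (vertex_labels \<delta> \<sigma>)\<close> leads from the root label at vertex 0 once
  around the cycle.
\<close>
definition vertex_labels :: "sign list \<Rightarrow> (nat \<Rightarrow> nat) \<Rightarrow> nat list" where
  "vertex_labels \<delta> \<sigma> = map (\<lambda>j. \<sigma> (next_vertex \<delta> j)) [0..<length \<delta>]"

text \<open>
  A possible assignment of the label of the root of its block to every vertex.
\<close>
definition trajectory :: "sign list \<Rightarrow> (nat \<Rightarrow> nat) \<Rightarrow> (nat \<Rightarrow> nat) \<Rightarrow> bool" where
  "trajectory \<delta> \<sigma> s \<longleftrightarrow> s ` vertices \<delta> \<subseteq> \<sigma> ` vertices \<delta> \<and>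
     (\<forall>j<length \<delta>. s (next_vertex \<delta> j) = root_step (\<delta> ! j) (s j) (\<sigma> (next_vertex \<delta> j)))"

lemma bij_next_vertex: "bij_betw (next_vertex \<delta>) (vertices \<delta>) (vertices \<delta>)"
  by (rule bij_betw_byWitness[where f' = "prev_vertex \<delta>"])
    (auto simp: prev_next next_prev next_vertex_less prev_vertex_less)

lemma set_vertex_labels: "set (vertex_labels \<delta> \<sigma>) = \<sigma> ` vertices \<delta>"
  using bij_betw_imp_surj_on[OF bij_next_vertex[of \<delta>]]
  by (auto simp: vertex_labels_def) (metis image_eqI imageE lessThan_iff atLeast0LessThan)+

lemma distinct_vertex_labels:
  assumes "inj_on \<sigma> (vertices \<delta>)"
  shows "distinct (vertex_labels \<delta> \<sigma>)"
proof -
  have "inj_on (\<sigma> \<circ> next_vertex \<delta>) (vertices \<delta>)"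
    using bij_next_vertex[of \<delta>] assms by (intro comp_inj_on) (auto simp: bij_betw_def)
  then show ?thesis
    by (simp add: vertex_labels_def distinct_map comp_def atLeast0LessThan)
qed

lemma trajectory_run:
  assumes "trajectory \<delta> \<sigma> s" "j \<le> length \<delta>"
  shows "run (take j \<delta>) (take j (vertex_labels \<delta> \<sigma>)) (s 0) = s (j mod length \<delta>) \<and>
         root_count (take j \<delta>) (take j (vertex_labels \<delta> \<sigma>)) (s 0) =
           card {i. i < j \<and> s (next_vertex \<delta> i) = \<sigma> (next_vertex \<delta> i)}"
  using assms(2)
proof (induction j)
  case (Suc j)
  let ?l = "vertex_labels \<delta> \<sigma>"
  have j: "j < length \<delta>" "j < length ?l" using Suc by (auto simp: vertex_labels_def)
  have lj: "?l ! j = \<sigma> (next_vertex \<delta> j)" using j by (simp add: vertex_labels_def)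
  have len: "length (take j \<delta>) = length (take j ?l)" using j by simp
  have st: "s (next_vertex \<delta> j) = root_step (\<delta> ! j) (s j) (?l ! j)"
    using assms(1) j lj by (simp add: trajectory_def)
  have "{i. i < Suc j \<and> s (next_vertex \<delta> i) = \<sigma> (next_vertex \<delta> i)} =
      {i. i < j \<and> s (next_vertex \<delta> i) = \<sigma> (next_vertex \<delta> i)} \<union>
      (if s (next_vertex \<delta> j) = \<sigma> (next_vertex \<delta> j) then {j} else {})"
    by (auto simp: less_Suc_eq)
  moreover have "s (Suc j mod length \<delta>) = s (next_vertex \<delta> j)" by (simp add: next_vertex_def)
  ultimately show ?case
    using Suc j len st lj
    by (simp add: take_Suc_conv_app_nth run_append root_count_append split: if_splits)
qed simp

lemma trajectory_cyc_roots:
  assumes "trajectory \<delta> \<sigma> s" "inj_on \<sigma> (vertices \<delta>)" "\<delta> \<noteq> []"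
  shows "run \<delta> (vertex_labels \<delta> \<sigma>) (s 0) = s 0"
    and "cyc_roots \<delta> (vertex_labels \<delta> \<sigma>) = card {j. j < length \<delta> \<and> s j = \<sigma> j}"
proof -
  let ?l = "vertex_labels \<delta> \<sigma>"
  have len: "length \<delta> = length ?l" by (simp add: vertex_labels_def)
  have r: "run \<delta> ?l (s 0) = s 0"
    "root_count \<delta> ?l (s 0) = card {i. i < length \<delta> \<and> s (next_vertex \<delta> i) = \<sigma> (next_vertex \<delta> i)}"
    using trajectory_run[OF assms(1), of "length \<delta>"] len by simp_all
  show "run \<delta> ?l (s 0) = s 0" by fact
  have s0: "s 0 \<in> set ?l" using assms by (auto simp: set_vertex_labels trajectory_def)
  have "bij_betw (next_vertex \<delta>)
      {i. i < length \<delta> \<and> s (next_vertex \<delta> i) = \<sigma> (next_vertex \<delta> i)}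
      {j. j < length \<delta> \<and> s j = \<sigma> j}"
    by (rule bij_betw_byWitness[where f' = "prev_vertex \<delta>"])
      (auto simp: prev_next next_prev next_vertex_less prev_vertex_less)
  then have "card {i. i < length \<delta> \<and> s (next_vertex \<delta> i) = \<sigma> (next_vertex \<delta> i)} =
      card {j. j < length \<delta> \<and> s j = \<sigma> j}" by (rule bij_betw_same_card)
  then show "cyc_roots \<delta> ?l = card {j. j < length \<delta> \<and> s j = \<sigma> j}"
    using cyc_roots_eq[OF len distinct_vertex_labels[OF assms(2)] s0 r(1)] r(2) by simp
qed

lemma trajectory_exists:
  assumes "\<delta> \<noteq> []"
  obtains s where "trajectory \<delta> \<sigma> s"
proof -
  let ?l = "vertex_labels \<delta> \<sigma>"
  define x where "x = run \<delta> ?l (hd ?l)"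
  define s where "s j = run (take j \<delta>) (take j ?l) x" for j
  have len: "length ?l = length \<delta>" by (simp add: vertex_labels_def)
  have "hd ?l \<in> set ?l" using assms len by (intro hd_in_set) auto
  then have x: "x \<in> set ?l" using run_in[of \<delta> ?l "hd ?l"] by (auto simp: x_def)
  have "s j \<in> set ?l" for j
    using run_in[of "take j \<delta>" "take j ?l" x] x set_take_subset[of j ?l] by (auto simp: s_def)
  moreover have "s (next_vertex \<delta> j) = root_step (\<delta> ! j) (s j) (\<sigma> (next_vertex \<delta> j))"
    if j: "j < length \<delta>" for j
  proof -
    have "s (Suc j) = root_step (\<delta> ! j) (s j) (\<sigma> (next_vertex \<delta> j))"
      using j len by (simp add: s_def take_Suc_conv_app_nth run_append) (simp add: vertex_labels_def)
    moreover have "s (length \<delta>) = s 0" using len by (simp add: s_def x_def run_idem)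
    ultimately show ?thesis using j by (auto simp: next_vertex_eq)
  qed
  ultimately have "trajectory \<delta> \<sigma> s" by (auto simp: trajectory_def set_vertex_labels)
  then show thesis by (rule that)
qed

text \<open>
  Trajectories correspond to fixed points of the run around the cycle; if two are different,
  \<open>run_two_fixed\<close> says that no step moves either of them.
\<close>
lemma trajectories_agree_or_constant:
  assumes "trajectory \<delta> \<sigma> s" "trajectory \<delta> \<sigma> t" "inj_on \<sigma> (vertices \<delta>)" "\<delta> \<noteq> []"
  shows "(\<forall>j<length \<delta>. s j = t j) \<or>
    (\<forall>j<length \<delta>. s j = s 0) \<and> (\<forall>j<length \<delta>. t j = t 0)"
proof -
  let ?l = "vertex_labels \<delta> \<sigma>"
  have const: "(\<forall>j<length \<delta>. s j = s 0) \<and> (\<forall>j<length \<delta>. t j = t 0)"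
    if "trajectory \<delta> \<sigma> s" "trajectory \<delta> \<sigma> t" "s 0 < t 0" for s t
  proof -
    have fix0: "root_step (\<delta> ! j) (s 0) (\<sigma> (next_vertex \<delta> j)) = s 0 \<and>
        root_step (\<delta> ! j) (t 0) (\<sigma> (next_vertex \<delta> j)) = t 0" if "j < length \<delta>" for j
    proof (rule run_two_fixed[of \<delta> ?l])
      show "(\<delta> ! j, \<sigma> (next_vertex \<delta> j)) \<in> set (zip \<delta> ?l)"
        using that by (auto simp: set_zip vertex_labels_def intro!: exI[of _ j])
    qed (use \<open>s 0 < t 0\<close> that \<open>trajectory \<delta> \<sigma> s\<close> \<open>trajectory \<delta> \<sigma> t\<close> assms(3,4)
        trajectory_cyc_roots(1) in blast)+
    have "s j = s 0 \<and> t j = t 0" if j: "j < length \<delta>" for j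
    proof (rule cycle_induct[of 0 \<delta> "\<lambda>j. s j = s 0 \<and> t j = t 0", OF _ _ _ j])
      fix i assume "i < length \<delta>" "s i = s 0 \<and> t i = t 0"
      then show "s (next_vertex \<delta> i) = s 0 \<and> t (next_vertex \<delta> i) = t 0"
        using that \<open>trajectory \<delta> \<sigma> s\<close> \<open>trajectory \<delta> \<sigma> t\<close> fix0 by (simp add: trajectory_def)
    qed (use assms in auto)
    then show ?thesis by blast
  qed
  consider "s 0 = t 0" | "s 0 < t 0" | "t 0 < s 0" by linarith
  then show ?thesis
  proof cases
    case 1
    have "s j = t j" if j: "j < length \<delta>" for j
    proof (rule cycle_induct[of 0 \<delta> "\<lambda>j. s j = t j", OF _ _ _ j])
    qed (use 1 assms in \<open>auto simp: trajectory_def\<close>)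
    then show ?thesis by blast
  next
    case 2
    then show ?thesis using const[of s t] assms by blast
  next
    case 3
    then show ?thesis using const[of t s] assms by blast
  qed
qed

definition fibres :: "'a set \<Rightarrow> ('a \<Rightarrow> 'b) \<Rightarrow> 'a set set" where
  "fibres A s = (\<lambda>j. {i \<in> A. s i = s j}) ` A"

lemma partition_on_fibres: "partition_on A (fibres A s)"
  by (rule partition_onI) (auto simp: fibres_def disjnt_def)

lemma fibres_trajectory_unique:
  assumes "trajectory \<delta> \<sigma> s" "trajectory \<delta> \<sigma> t" "inj_on \<sigma> (vertices \<delta>)" "\<delta> \<noteq> []"
  shows "fibres (vertices \<delta>) s = fibres (vertices \<delta>) t"
  unfolding fibres_def
proof (rule image_cong)
  fix j assume "j \<in> vertices \<delta>"
  then show "{i \<in> vertices \<delta>. s i = s j} = {i \<in> vertices \<delta>. t i = t j}"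
    using trajectories_agree_or_constant[OF assms] by auto
qed simp

text \<open>
  A value that is absent at \<open>r\<close> can only be picked up at the vertex labelled by it, which
  is \<open>r\<close> itself; so it is absent everywhere.
\<close>
lemma trajectory_root:
  assumes "trajectory \<delta> \<sigma> s" "inj_on \<sigma> (vertices \<delta>)" "j < length \<delta>" "r < length \<delta>" "\<sigma> r = s j"
  shows "s r = \<sigma> r"
proof (rule ccontr)
  assume ne: "s r \<noteq> \<sigma> r"
  have "s j \<noteq> \<sigma> r"
  proof (rule cycle_induct[of r \<delta> "\<lambda>j. s j \<noteq> \<sigma> r", OF assms(4) ne _ assms(3)])
    fix i assume i: "i < length \<delta>" "s i \<noteq> \<sigma> r"
    let ?i = "next_vertex \<delta> i"
    have "s ?i = root_step (\<delta> ! i) (s i) (\<sigma> ?i)" using assms(1) i by (simp add: trajectory_def)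
    then have "s ?i = s i \<or> s ?i = \<sigma> ?i" by (cases "\<delta> ! i") (auto simp: max_def min_def)
    moreover have "?i = r" if "\<sigma> ?i = \<sigma> r"
      using that assms(2,4) next_vertex_less[OF i(1)] by (auto dest: inj_onD)
    ultimately show "s ?i \<noteq> \<sigma> r" using i ne by metis
  qed
  then show False using assms by simp
qed

lemma trajectory_prev:
  assumes "trajectory \<delta> \<sigma> s" "j < length \<delta>"
  shows "s j = root_step (\<delta> ! prev_vertex \<delta> j) (s (prev_vertex \<delta> j)) (\<sigma> j)"
proof -
  let ?i = "prev_vertex \<delta> j"
  have "s (next_vertex \<delta> ?i) = root_step (\<delta> ! ?i) (s ?i) (\<sigma> (next_vertex \<delta> ?i))"
    using assms(1) prev_vertex_less[OF assms(2)] by (simp add: trajectory_def)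
  then show ?thesis using next_prev[OF assms(2)] by simp
qed

text \<open>
  Every fibre contains exactly one vertex whose label is the common value.
\<close>
lemma card_fibres_trajectory:
  assumes "trajectory \<delta> \<sigma> s" "inj_on \<sigma> (vertices \<delta>)"
  shows "card (fibres (vertices \<delta>) s) = card {j. j < length \<delta> \<and> s j = \<sigma> j}"
proof -
  let ?R = "{j. j < length \<delta> \<and> s j = \<sigma> j}" and ?F = "\<lambda>j. {i \<in> vertices \<delta>. s i = s j}"
  have "inj_on ?F ?R"
  proof (rule inj_onI)
    fix i j assume ij: "i \<in> ?R" "j \<in> ?R" "?F i = ?F j"
    have "i \<in> ?F i" using ij(1) by simp
    then have "s i = s j" unfolding ij(3) by simp
    then have "\<sigma> i = \<sigma> j" using ij(1,2) by simp
    then show "i = j" using ij(1,2) assms(2) by (auto dest: inj_onD)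
  qed
  moreover have "?F ` ?R = fibres (vertices \<delta>) s"
    unfolding fibres_def
  proof
    show "?F ` ?R \<subseteq> ?F ` vertices \<delta>" by (intro image_mono) auto
    show "?F ` vertices \<delta> \<subseteq> ?F ` ?R"
    proof (rule image_subsetI)
      fix j assume "j \<in> vertices \<delta>"
      then have j: "j < length \<delta>" by simp
      then have "s j \<in> \<sigma> ` vertices \<delta>" using assms(1) by (auto simp: trajectory_def)
      then obtain r where r: "r < length \<delta>" "\<sigma> r = s j" by auto
      then have "s r = \<sigma> r" using trajectory_root[OF assms j] by simp
      then show "?F j \<in> ?F ` ?R" using r by (intro image_eqI[of _ _ r]) auto
    qed
  qed
  ultimately show ?thesis using card_image[of ?F ?R] by simp
qed

lemma vertex_offset_less: "r < length \<delta> \<Longrightarrow> (r + i) mod length \<delta> < length \<delta>"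
  by (rule mod_less_divisor) auto

section \<open>Valid block partitions\<close>

lemma cyclic_interval_offset:
  assumes "s < length \<delta>" "j \<in> cyclic_interval \<delta> s k" "j \<noteq> s"
  shows "prev_vertex \<delta> j \<in> cyclic_interval \<delta> s k"
proof -
  obtain i where i: "i < k" "j = (s + i) mod length \<delta>"
    using assms(2) by (auto simp: cyclic_interval_def)
  then obtain i' where i': "i = Suc i'" using assms(1,3) by (cases i) auto
  have "(s + i') mod length \<delta> < length \<delta>" using vertex_offset_less[OF assms(1)] .
  then have "prev_vertex \<delta> j = (s + i') mod length \<delta>"
    unfolding i(2) i' next_vertex_shift[symmetric] by (rule prev_next)
  then show ?thesis using i(1) i' by (auto simp: cyclic_interval_def)
qed

text \<open>
  A cyclic interval that contained the predecessor of its first vertex would be closed under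
  predecessors and hence be the whole cycle.
\<close>
lemma cyclic_interval_first:
  assumes "s < length \<delta>" "1 \<le> k" "cyclic_interval \<delta> s k \<noteq> vertices \<delta>" "j < length \<delta>"
  shows "j \<in> cyclic_interval \<delta> s k \<and> prev_vertex \<delta> j \<notin> cyclic_interval \<delta> s k \<longleftrightarrow> j = s"
proof -
  let ?B = "cyclic_interval \<delta> s k"
  have s: "s \<in> ?B"
    using assms(1,2) by (auto simp: cyclic_interval_def intro!: image_eqI[of _ _ 0])
  have sub: "?B \<subseteq> vertices \<delta>"
    using vertex_offset_less[OF assms(1)] by (auto simp: cyclic_interval_def)
  have "prev_vertex \<delta> s \<notin> ?B"
  proof
    assume *: "prev_vertex \<delta> s \<in> ?B"
    have "i \<in> ?B" if "i < length \<delta>" for i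
      by (rule cycle_induct_prev[of s \<delta> "\<lambda>i. i \<in> ?B", OF assms(1) s _ that])
        (use * cyclic_interval_offset[OF assms(1)] in metis)
    then show False using sub assms(3) by auto
  qed
  then show ?thesis using s cyclic_interval_offset[OF assms(1)] by metis
qed

lemma cyclic_intervalI:
  assumes "r \<in> B" "B \<subseteq> vertices \<delta>" "\<And>j. j \<in> B \<Longrightarrow> j \<noteq> r \<Longrightarrow> prev_vertex \<delta> j \<in> B"
  shows "\<exists>k\<ge>1. k \<le> length \<delta> \<and> B = cyclic_interval \<delta> r k"
proof -
  let ?n = "length \<delta>"
  have r: "r < ?n" using assms by auto
  \<comment> \<open>Offsets from \<open>r\<close> of the elements of \<open>B\<close>; by the hypothesis on predecessors they form
    an initial segment, so \<open>B\<close> has length \<open>Suc (Max I)\<close>.\<close>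
  define I where "I = {i. i < ?n \<and> (r + i) mod ?n \<in> B}"
  have fin: "finite I" by (simp add: I_def)
  have "0 \<in> I" using assms(1) r by (auto simp: I_def)
  then have MI: "Max I \<in> I" using fin by (intro Max_in) auto
  have down: "i \<in> I" if "Suc i \<in> I" for i
  proof -
    have i: "Suc i < ?n" "(r + Suc i) mod ?n \<in> B" using that by (auto simp: I_def)
    have "(r + Suc i) mod ?n \<noteq> r"
      using r i(1) by (cases "r + Suc i < ?n") (auto simp: mod_if)
    from assms(3)[OF i(2) this] have "prev_vertex \<delta> (next_vertex \<delta> ((r + i) mod ?n)) \<in> B"
      by (simp only: next_vertex_shift)
    moreover have "(r + i) mod ?n < ?n" using vertex_offset_less[OF r] .
    ultimately show ?thesis using i(1) by (simp add: I_def prev_next)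
  qed
  have le: "i \<in> I" if "i \<le> Max I" for i
    using that by (induction rule: inc_induct) (use MI down in auto)
  have "B = cyclic_interval \<delta> r (Suc (Max I))"
  proof (intro equalityI subsetI)
    fix j assume j: "j \<in> B"
    then have "j < ?n" using assms(2) by auto
    then obtain i where i: "i < ?n" "j = (r + i) mod ?n" using vertex_offset[OF r] by metis
    then have "i \<in> I" using j by (simp add: I_def)
    then have "i \<le> Max I" using fin by simp
    then show "j \<in> cyclic_interval \<delta> r (Suc (Max I))"
      using i by (auto simp: cyclic_interval_def)
  next
    fix j assume "j \<in> cyclic_interval \<delta> r (Suc (Max I))"
    then obtain i where "i \<le> Max I" "j = (r + i) mod ?n"
      by (auto simp: cyclic_interval_def less_Suc_eq_le)
    then show "j \<in> B" using le[of i] by (simp add: I_def)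
  qed
  moreover have "Suc (Max I) \<le> ?n" using MI by (simp add: I_def)
  ultimately show ?thesis by (intro exI[of _ "Suc (Max I)"]) simp
qed

lemma block_root_interval:
  assumes "s < length \<delta>" "1 \<le> k" "B = cyclic_interval \<delta> s k" "B \<noteq> vertices \<delta>"
  shows "block_root \<delta> \<sigma> B = s"
proof -
  have "(THE s. s \<in> vertices \<delta> \<and> (\<exists>k\<ge>1. B = cyclic_interval \<delta> s k)) = s"
  proof (rule the_equality)
    fix s' assume s': "s' \<in> vertices \<delta> \<and> (\<exists>k\<ge>1. B = cyclic_interval \<delta> s' k)"
    then obtain k' where k': "k' \<ge> 1" "B = cyclic_interval \<delta> s' k'" by blast
    have "s' \<in> B \<and> prev_vertex \<delta> s' \<notin> B"
      using cyclic_interval_first[of s' \<delta> k' s'] s' k' assms(4) by simp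
    then show "s' = s" using cyclic_interval_first[of s \<delta> k s'] s' assms by simp
  qed (use assms in auto)
  then show ?thesis using assms(4) by (simp add: block_root_def)
qed

lemma block_root_first:
  assumes "circular_block_partition \<delta> P" "B \<in> P" "B \<noteq> vertices \<delta>" "j < length \<delta>"
  shows "j \<in> B \<and> prev_vertex \<delta> j \<notin> B \<longleftrightarrow> j = block_root \<delta> \<sigma> B"
proof -
  obtain s k where "s < length \<delta>" "1 \<le> k" "B = cyclic_interval \<delta> s k"
    using assms(1,2) unfolding circular_block_partition_def by auto
  then show ?thesis
    using cyclic_interval_first[of s \<delta> k j] block_root_interval[of s \<delta> k B \<sigma>] assms(3,4) by simp
qed

lemma block_root_vertices:
  fixes \<sigma> :: "nat \<Rightarrow> nat"
  assumes "\<exists>j<length \<delta>. ascent_vertex \<delta> j"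
  defines "r \<equiv> block_root \<delta> \<sigma> (vertices \<delta>)"
  shows "r < length \<delta>" "ascent_vertex \<delta> r"
    and "\<And>j. j < length \<delta> \<Longrightarrow> ascent_vertex \<delta> j \<Longrightarrow> \<sigma> j \<le> \<sigma> r"
proof -
  let ?Q = "\<lambda>j. j \<in> vertices \<delta> \<and> ascent_vertex \<delta> j"
  obtain k where k: "?Q k" using assms(1) by auto
  have bound: "\<forall>j. ?Q j \<longrightarrow> \<sigma> j < Suc (Max (\<sigma> ` vertices \<delta>))" by (auto simp: less_Suc_eq_le)
  have r: "r = arg_max \<sigma> ?Q" by (simp add: r_def block_root_def)
  have "?Q r" unfolding r by (rule arg_max_natI[OF k bound])
  then show "r < length \<delta>" "ascent_vertex \<delta> r" by auto
  show "\<And>j. j < length \<delta> \<Longrightarrow> ascent_vertex \<delta> j \<Longrightarrow> \<sigma> j \<le> \<sigma> r"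
    unfolding r by (rule arg_max_nat_le[OF _ bound]) auto
qed

text \<open>
  Send every vertex to the label of the root of its block. Condition (i) gives the recursion at
  vertices inside a block and condition (ii) at roots. Different blocks have roots with different
  labels, so the fibres are the blocks.
\<close>
lemma valid_partition_trajectory:
  assumes valid: "valid_block_partition \<delta> \<sigma> P" and inj: "inj_on \<sigma> (vertices \<delta>)"
    and asc: "\<exists>j<length \<delta>. ascent_vertex \<delta> j"
  obtains s where "trajectory \<delta> \<sigma> s" "P = fibres (vertices \<delta>) s"
proof -
  let ?V = "vertices \<delta>" and ?r = "block_root \<delta> \<sigma>"
  have part: "partition_on ?V P" and cbp: "circular_block_partition \<delta> P"
    and bc: "\<And>B. B \<in> P \<Longrightarrow> block_condition \<delta> \<sigma> B"
    and rc: "2 \<le> card P \<Longrightarrow> root_condition \<delta> \<sigma> P"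
    using valid by (auto simp: valid_block_partition_def circular_block_partition_def)
  have cover: "\<Union>P = ?V" using partition_onD1[OF part] by simp
  have same: "B = B'" if "B \<in> P" "B' \<in> P" "j \<in> B" "j \<in> B'" for B B' j
    using disjointD[OF partition_onD2[OF part], of B B'] that by auto
  have sub: "B \<subseteq> ?V" if "B \<in> P" for B using cover that by auto
  have root: "?r B \<in> B" if B: "B \<in> P" for B
  proof (cases "B = ?V")
    case True
    then show ?thesis using block_root_vertices(1)[OF asc] by simp
  next
    case False
    obtain s k where s: "s < length \<delta>" "1 \<le> k" "B = cyclic_interval \<delta> s k"
      using cbp B unfolding circular_block_partition_def by auto
    then show ?thesis
      using cyclic_interval_first[of s \<delta> k s] block_root_interval[OF s False, of \<sigma>] False by simp
  qed
  \<comment> \<open>The block of a vertex.\<close>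
  define blk where "blk j = (THE B. B \<in> P \<and> j \<in> B)" for j
  have blk: "blk j = B" if "B \<in> P" "j \<in> B" for B j
    unfolding blk_def using that same by (intro the_equality) auto
  have blkP: "blk j \<in> P \<and> j \<in> blk j" if "j < length \<delta>" for j
  proof -
    have "j \<in> \<Union>P" using cover that by simp
    then obtain B where "B \<in> P" "j \<in> B" by blast
    then show ?thesis using blk by simp
  qed
  define s where "s j = \<sigma> (?r (blk j))" for j
  have eq: "s i = s j \<longleftrightarrow> blk i = blk j" if "i < length \<delta>" "j < length \<delta>" for i j
  proof
    assume "s i = s j"
    moreover have "?r (blk i) \<in> ?V" "?r (blk j) \<in> ?V" using blkP that root sub by blast+
    ultimately have "?r (blk i) = ?r (blk j)" using inj by (auto simp: s_def dest: inj_onD)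
    then show "blk i = blk j" using same root blkP that by metis
  qed (simp add: s_def)
  have "trajectory \<delta> \<sigma> s"
    unfolding trajectory_def
  proof (intro conjI allI impI image_subsetI)
    fix j assume "j \<in> ?V"
    then have "?r (blk j) \<in> ?V" using blkP[of j] root sub by blast
    then show "s j \<in> \<sigma> ` ?V" by (simp add: s_def)
  next
    fix j assume j: "j < length \<delta>"
    define i where "i = next_vertex \<delta> j"
    have i: "i < length \<delta>" "prev_vertex \<delta> i = j"
      using j by (auto simp: i_def next_vertex_less prev_next)
    have Bi: "blk i \<in> P" "i \<in> blk i" and Bj: "blk j \<in> P" "j \<in> blk j" using blkP i j by auto
    have type: "ascent_vertex \<delta> i \<longleftrightarrow> \<delta> ! j = Minus" "descent_vertex \<delta> i \<longleftrightarrow> \<delta> ! j = Plus"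
      by (auto simp: ascent_vertex_def descent_vertex_def i)
    show "s (next_vertex \<delta> j) = root_step (\<delta> ! j) (s j) (\<sigma> (next_vertex \<delta> j))"
      unfolding i_def[symmetric]
    proof (cases "i = ?r (blk i)")
      case False
      have "blk j = blk i"
      proof (cases "blk i = ?V")
        case True
        then show "blk j = blk i" using same[OF Bj(1) Bi(1) Bj(2)] j by simp
      next
        case neq: False
        then have "j \<in> blk i"
          using block_root_first[OF cbp Bi(1) neq i(1), of \<sigma>] False Bi(2) i(2) by simp
        then show "blk j = blk i" using same[OF Bj(1) Bi(1) Bj(2)] by simp
      qed
      then have sj: "s j = \<sigma> (?r (blk i))" "s i = \<sigma> (?r (blk i))" by (simp_all add: s_def)
      have "(ascent_vertex \<delta> i \<longrightarrow> \<sigma> i < \<sigma> (?r (blk i))) \<and>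
          (descent_vertex \<delta> i \<longrightarrow> \<sigma> i > \<sigma> (?r (blk i)))"
        using bc[OF Bi(1)] Bi(2) False unfolding block_condition_def by blast
      then show "s i = root_step (\<delta> ! j) (s j) (\<sigma> i)"
        unfolding sj type by (cases "\<delta> ! j") auto
    next
      case True
      show "s i = root_step (\<delta> ! j) (s j) (\<sigma> i)"
      proof (cases "blk i = ?V")
        case V: True
        then have "blk j = blk i" using same[OF Bj(1) Bi(1) Bj(2)] j by simp
        then have "s j = \<sigma> i" "s i = \<sigma> i" using True by (simp_all add: s_def)
        then show ?thesis by (cases "\<delta> ! j") auto
      next
        case V: False
        then have nj: "j \<notin> blk i"
          using block_root_first[OF cbp Bi(1) V i(1), of \<sigma>] True i(2) by simp
        then have ne: "blk i \<noteq> blk j" using Bj(2) by metis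
        have "finite P" using part by (rule finite_elements[rotated]) simp
        then have "2 \<le> card P" using card_mono[of P "{blk i, blk j}"] ne Bi(1) Bj(1) by simp
        from rc[OF this] have "(ascent_vertex \<delta> i \<longrightarrow> \<sigma> i > s j) \<and> (descent_vertex \<delta> i \<longrightarrow> \<sigma> i < s j)"
          unfolding root_condition_def follows_block_def s_def
          using Bi(1) Bj True i(2) by metis
        moreover have "s i = \<sigma> i" using True by (simp add: s_def)
        ultimately show ?thesis unfolding type by (cases "\<delta> ! j") auto
      qed
    qed
  qed
  moreover have "P = fibres ?V s"
  proof -
    have fib: "{i \<in> ?V. s i = s j} = blk j" if j: "j < length \<delta>" for j
    proof (intro equalityI subsetI)
      fix i assume i: "i \<in> {i \<in> ?V. s i = s j}"
      then have "blk i = blk j" using eq[of i j] j by simp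
      then show "i \<in> blk j" using blkP[of i] i by simp
    next
      fix i assume i: "i \<in> blk j"
      then have iV: "i < length \<delta>" using sub[of "blk j"] blkP[OF j] by auto
      have "blk i = blk j" using blk[of "blk j" i] blkP[OF j] i by simp
      then show "i \<in> {i \<in> ?V. s i = s j}" using iV by (simp add: s_def)
    qed
    have "P = blk ` ?V"
    proof (intro equalityI subsetI)
      fix B assume B: "B \<in> P"
      then have "blk (?r B) = B" "?r B \<in> ?V" using root blk sub by blast+
      then show "B \<in> blk ` ?V" by (intro image_eqI[of _ _ "?r B"]) simp_all
    qed (use blkP in auto)
    also have "\<dots> = fibres ?V s" unfolding fibres_def using fib by (intro image_cong) auto
    finally show ?thesis .
  qed
  ultimately show thesis by (rule that)
qed

text \<open>
  The value of a fibre is the label of a vertex \<open>r\<close> in it, and the trajectory can change to this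
  value only at \<open>r\<close>. So the fibre extends from \<open>r\<close> without gaps.
\<close>
lemma fibre_root:
  assumes "trajectory \<delta> \<sigma> s" "inj_on \<sigma> (vertices \<delta>)" "B \<in> fibres (vertices \<delta>) s"
  obtains r where "r < length \<delta>" "B = {i \<in> vertices \<delta>. s i = \<sigma> r}" "r \<in> B"
    "\<forall>j\<in>B. j \<noteq> r \<longrightarrow> prev_vertex \<delta> j \<in> B"
proof -
  obtain j where j: "j < length \<delta>" "B = {i \<in> vertices \<delta>. s i = s j}"
    using assms(3) by (auto simp: fibres_def)
  have "s j \<in> \<sigma> ` vertices \<delta>" using assms(1) j(1) by (auto simp: trajectory_def)
  then obtain r where r: "r < length \<delta>" "\<sigma> r = s j" by auto
  have sr: "s r = \<sigma> r" by (rule trajectory_root[OF assms(1,2) j(1) r])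
  have B: "B = {i \<in> vertices \<delta>. s i = \<sigma> r}" using j r by simp
  have "prev_vertex \<delta> i \<in> B" if i: "i \<in> B" "i \<noteq> r" for i
  proof -
    have iV: "i < length \<delta>" "s i = \<sigma> r" using i B by auto
    have "s i = s (prev_vertex \<delta> i) \<or> s i = \<sigma> i"
      using trajectory_prev[OF assms(1) iV(1)]
      by (cases "\<delta> ! prev_vertex \<delta> i") (auto simp: max_def min_def)
    moreover have "\<sigma> i \<noteq> \<sigma> r" using inj_onD[OF assms(2), of i r] iV(1) r(1) i(2) by auto
    ultimately show ?thesis using iV prev_vertex_less[OF iV(1)] by (auto simp: B)
  qed
  then show thesis using that[OF r(1) B] B r(1) sr by auto
qed

text \<open>
  If there are several fibres, each one begins at the vertex that carries its value, and (i) and (ii)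
  restate the recursion. If the trajectory is constant with value \<open>v\<close>, all ascent labels are at most
  \<open>v\<close> and all descent labels at least \<open>v\<close>; then (i) also holds for the largest ascent label,
  whether or not that is \<open>v\<close>.
\<close>
lemma valid_partition_fibres:
  assumes traj: "trajectory \<delta> \<sigma> s" and inj: "inj_on \<sigma> (vertices \<delta>)"
    and asc: "\<exists>j<length \<delta>. ascent_vertex \<delta> j"
  shows "valid_block_partition \<delta> \<sigma> (fibres (vertices \<delta>) s)"
proof -
  let ?V = "vertices \<delta>" and ?P = "fibres (vertices \<delta>) s" and ?r = "block_root \<delta> \<sigma>"
  have interval: "\<exists>r\<in>?V. \<exists>k. 1 \<le> k \<and> k \<le> length \<delta> \<and> B = cyclic_interval \<delta> r k \<and>
      B = {i \<in> ?V. s i = \<sigma> r} \<and> r \<in> B" if B: "B \<in> ?P" for B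
  proof -
    obtain r where r: "r < length \<delta>" "B = {i \<in> ?V. s i = \<sigma> r}" "r \<in> B"
      "\<forall>j\<in>B. j \<noteq> r \<longrightarrow> prev_vertex \<delta> j \<in> B"
      using fibre_root[OF traj inj B] .
    have "B \<subseteq> ?V" using r(2) by auto
    then obtain k where "1 \<le> k" "k \<le> length \<delta>" "B = cyclic_interval \<delta> r k"
      using cyclic_intervalI[OF r(3)] r(4) by blast
    then show ?thesis using r(1-3) by blast
  qed
  have cbp: "circular_block_partition \<delta> ?P"
    unfolding circular_block_partition_def using partition_on_fibres interval by blast
  have root: "?r B < length \<delta> \<and> ?r B \<in> B \<and> B = {i \<in> ?V. s i = \<sigma> (?r B)}"
    if B: "B \<in> ?P" "B \<noteq> ?V" for B
  proof -
    obtain r k where "r < length \<delta>" "1 \<le> k" "B = cyclic_interval \<delta> r k"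
      "B = {i \<in> ?V. s i = \<sigma> r}" "r \<in> B" using interval[OF B(1)] by auto
    then show ?thesis using block_root_interval[of r \<delta> k B \<sigma>] B(2) by simp
  qed
  have step: "(ascent_vertex \<delta> j \<longrightarrow> s j = max (s (prev_vertex \<delta> j)) (\<sigma> j)) \<and>
      (descent_vertex \<delta> j \<longrightarrow> s j = min (s (prev_vertex \<delta> j)) (\<sigma> j))" if "j < length \<delta>" for j
    using trajectory_prev[OF traj that] by (auto simp: ascent_vertex_def descent_vertex_def)
  have neq: "\<sigma> i \<noteq> \<sigma> j" if "i < length \<delta>" "j < length \<delta>" "i \<noteq> j" for i j
    using inj_onD[OF inj, of i j] that by auto
  have bc: "block_condition \<delta> \<sigma> B" if B: "B \<in> ?P" for B
    unfolding block_condition_def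
  proof (intro ballI)
    fix j assume j: "j \<in> B - {?r B}"
    show "(ascent_vertex \<delta> j \<longrightarrow> \<sigma> j < \<sigma> (?r B)) \<and> (descent_vertex \<delta> j \<longrightarrow> \<sigma> j > \<sigma> (?r B))"
    proof (cases "B = ?V")
      case False
      have r: "?r B < length \<delta>" "?r B \<in> B" "B = {i \<in> ?V. s i = \<sigma> (?r B)}"
        using root[OF B False] by auto
      have jn: "j < length \<delta>" "s j = \<sigma> (?r B)" using j r(3) by auto
      have "prev_vertex \<delta> j \<in> B"
        using block_root_first[OF cbp B False jn(1), of \<sigma>] j by auto
      then have "s (prev_vertex \<delta> j) = \<sigma> (?r B)" using r(3) by auto
      moreover have "\<sigma> j \<noteq> \<sigma> (?r B)" using neq[OF jn(1) r(1)] j by auto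
      ultimately show ?thesis using step[OF jn(1)] jn(2) by (auto simp: max_def min_def split: if_splits)
    next
      case True
      obtain v where v: "v < length \<delta>" "B = {i \<in> ?V. s i = \<sigma> v}"
        using interval[OF B] by auto
      have const: "s i = \<sigma> v" if "i < length \<delta>" for i using v True that by auto
      have cond: "(ascent_vertex \<delta> i \<longrightarrow> \<sigma> i \<le> \<sigma> v) \<and> (descent_vertex \<delta> i \<longrightarrow> \<sigma> v \<le> \<sigma> i)"
        if "i < length \<delta>" for i
        using step[OF that] const[OF that] const[OF prev_vertex_less[OF that]] by auto
      have r: "?r B < length \<delta>" "ascent_vertex \<delta> (?r B)"
        "\<And>i. i < length \<delta> \<Longrightarrow> ascent_vertex \<delta> i \<Longrightarrow> \<sigma> i \<le> \<sigma> (?r B)"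
        using block_root_vertices[OF asc, where \<sigma> = \<sigma>] True by blast+
      have jn: "j < length \<delta>" "\<sigma> j \<noteq> \<sigma> (?r B)" using j True neq[OF _ r(1), of j] by auto
      show ?thesis using cond[OF jn(1)] cond[OF r(1)] r(2) r(3)[OF jn(1)] jn(2) by auto
    qed
  qed
  have rc: "root_condition \<delta> \<sigma> ?P" if "2 \<le> card ?P"
    unfolding root_condition_def
  proof (intro ballI impI)
    fix B B' assume B: "B \<in> ?P" "B' \<in> ?P" and f: "follows_block \<delta> \<sigma> B B'"
    have nV: "C \<noteq> ?V" if "C \<in> ?P" for C
    proof
      assume "C = ?V"
      have "D = ?V" if "D \<in> ?P" for D
      proof -
        have "D \<noteq> {}" "D \<subseteq> ?V" using partition_onD3[OF partition_on_fibres] that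
          by (auto simp: fibres_def)
        then have "C \<inter> D \<noteq> {}" using \<open>C = ?V\<close> by auto
        then show ?thesis
          using disjointD[OF partition_onD2[OF partition_on_fibres] \<open>C \<in> ?P\<close> that] \<open>C = ?V\<close> by auto
      qed
      then have "?P \<subseteq> {?V}" by auto
      then have "card ?P \<le> 1" using card_mono[of "{?V}" ?P] by simp
      then show False using \<open>2 \<le> card ?P\<close> by simp
    qed
    have r: "?r B < length \<delta>" "B = {i \<in> ?V. s i = \<sigma> (?r B)}" using root[OF B(1) nV[OF B(1)]] by auto
    have r': "?r B' < length \<delta>" "?r B' \<in> B'" "B' = {i \<in> ?V. s i = \<sigma> (?r B')}"
      using root[OF B(2) nV[OF B(2)]] by auto
    let ?p = "prev_vertex \<delta> (?r B')"
    have p: "?p \<in> B" using f by (simp add: follows_block_def)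
    then have sp: "s ?p = \<sigma> (?r B)" using r(2) by auto
    have sr: "s (?r B') = \<sigma> (?r B')" using r'(2,3) by auto
    have "?p \<notin> B'" using block_root_first[OF cbp B(2) nV[OF B(2)] r'(1), of \<sigma>] by simp
    then have "?r B \<noteq> ?r B'" using p r(2) r'(3) by metis
    then have "\<sigma> (?r B) \<noteq> \<sigma> (?r B')" using neq r(1) r'(1) by blast
    then show "(ascent_vertex \<delta> (?r B') \<longrightarrow> \<sigma> (?r B') > \<sigma> (?r B)) \<and>
       (descent_vertex \<delta> (?r B') \<longrightarrow> \<sigma> (?r B') < \<sigma> (?r B))"
      using step[OF r'(1)] unfolding sp sr by (auto simp: max_def min_def split: if_splits)
  qed
  show ?thesis unfolding valid_block_partition_def using cbp bc rc by blast
qed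

lemma bl_circ_eq_cyc_roots:
  assumes "inj_on \<sigma> (vertices \<delta>)" "\<exists>j<length \<delta>. ascent_vertex \<delta> j"
  shows "bl_circ \<delta> \<sigma> = cyc_roots \<delta> (vertex_labels \<delta> \<sigma>)"
proof -
  have ne: "\<delta> \<noteq> []" using assms(2) by auto
  obtain s where s: "trajectory \<delta> \<sigma> s" using trajectory_exists[OF ne] .
  have "(THE P. valid_block_partition \<delta> \<sigma> P) = fibres (vertices \<delta>) s"
  proof (rule the_equality)
    fix P assume "valid_block_partition \<delta> \<sigma> P"
    then obtain t where "trajectory \<delta> \<sigma> t" "P = fibres (vertices \<delta>) t"
      using valid_partition_trajectory[OF _ assms] by metis
    then show "P = fibres (vertices \<delta>) s"
      using fibres_trajectory_unique[OF _ s assms(1) ne] by simp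
  qed (rule valid_partition_fibres[OF s assms])
  then show ?thesis
    unfolding bl_circ_def
    using card_fibres_trajectory[OF s assms(1)] trajectory_cyc_roots(2)[OF s assms(1) ne] by simp
qed

section \<open>The order polynomial\<close>

text \<open>
  An injection into a set with the same number \<open>n!\<close> of elements.
\<close>
lemma bij_vertex_labels:
  "bij_betw (vertex_labels \<delta>) {\<sigma>. \<sigma> permutes vertices \<delta>} (distinct_lists (vertices \<delta>) (length \<delta>))"
proof -
  let ?A = "{\<sigma>. \<sigma> permutes vertices \<delta>}" and ?D = "distinct_lists (vertices \<delta>) (length \<delta>)"
  have inj: "inj_on (vertex_labels \<delta>) ?A"
  proof (rule inj_onI)
    fix \<sigma> \<tau> assume st: "\<sigma> \<in> ?A" "\<tau> \<in> ?A" "vertex_labels \<delta> \<sigma> = vertex_labels \<delta> \<tau>"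
    have *: "\<sigma> (next_vertex \<delta> j) = \<tau> (next_vertex \<delta> j)" if "j < length \<delta>" for j
      using arg_cong[OF st(3), of "\<lambda>l. l ! j"] that by (simp add: vertex_labels_def)
    show "\<sigma> = \<tau>"
    proof
      fix v show "\<sigma> v = \<tau> v"
      proof (cases "v < length \<delta>")
        case True
        then show ?thesis using *[OF prev_vertex_less[OF True]] by (simp add: next_prev)
      next
        case False
        then show ?thesis using st(1,2) by (simp add: permutes_not_in)
      qed
    qed
  qed
  have "vertex_labels \<delta> ` ?A \<subseteq> ?D"
  proof (rule image_subsetI)
    fix \<sigma> assume "\<sigma> \<in> ?A"
    then have "\<sigma> ` vertices \<delta> = vertices \<delta>" "inj_on \<sigma> (vertices \<delta>)"
      by (simp_all add: permutes_image permutes_inj_on)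
    then show "vertex_labels \<delta> \<sigma> \<in> ?D"
      using set_vertex_labels[of \<delta> \<sigma>] distinct_vertex_labels[of \<sigma> \<delta>]
      by (simp add: distinct_lists_def) (simp add: vertex_labels_def)
  qed
  moreover have "card (vertex_labels \<delta> ` ?A) = card ?D"
    unfolding card_image[OF inj] by (simp add: card_permutations card_distinct_lists_all)
  ultimately have "vertex_labels \<delta> ` ?A = ?D"
    by (intro card_subset_eq finite_distinct_lists) auto
  then show ?thesis using inj by (simp add: bij_betw_def)
qed

lemma fact_times_order_preserving_maps:
  assumes "Minus \<in> set \<delta>" "1 \<le> m"
  shows "fact (length \<delta>) * card (order_preserving_maps (vertices \<delta>) (circular_fence \<delta>) m) =
         (\<Sum>\<sigma> | \<sigma> permutes vertices \<delta>. m ^ bl_circ \<delta> \<sigma>)"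
proof -
  obtain i where i: "i < length \<delta>" "\<delta> ! i = Minus" using assms(1) by (auto simp: in_set_conv_nth)
  then have asc: "\<exists>j<length \<delta>. ascent_vertex \<delta> j"
    by (intro exI[of _ "next_vertex \<delta> i"]) (simp add: ascent_vertex_def next_vertex_less prev_next)
  have ne: "\<delta> \<noteq> []" using assms by auto
  have "(\<Sum>\<sigma> | \<sigma> permutes vertices \<delta>. m ^ bl_circ \<delta> \<sigma>) =
      (\<Sum>\<sigma> | \<sigma> permutes vertices \<delta>. m ^ cyc_roots \<delta> (vertex_labels \<delta> \<sigma>))"
    by (intro sum.cong) (auto simp: bl_circ_eq_cyc_roots[OF _ asc] permutes_inj_on)
  also have "\<dots> = (\<Sum>l\<in>distinct_lists (vertices \<delta>) (length \<delta>). m ^ cyc_roots \<delta> l)"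
    by (rule sum.reindex_bij_betw[OF bij_vertex_labels])
  also have "\<dots> = fact (length \<delta>) * closed_walks m \<delta>"
    using sum_cyc_roots[OF ne refl assms(2)] .
  finally show ?thesis using card_order_preserving_maps[OF ne] by simp
qed

lemma order_polynomial_eqI:
  assumes "\<And>m. 1 \<le> m \<Longrightarrow> poly p (of_nat m) = of_nat (card (order_preserving_maps A r m))"
  shows "order_polynomial A r = p"
  unfolding order_polynomial_def
proof (rule the_equality)
  fix q :: "rat poly"
  assume q: "\<forall>m\<ge>1. poly q (of_nat m) = of_nat (card (order_preserving_maps A r m))"
  show "q = p"
  proof (rule ccontr)
    assume "q \<noteq> p"
    then have "finite {x. poly (q - p) x = 0}" by (intro poly_roots_finite) simp
    moreover have "of_nat ` {1::nat..} \<subseteq> {x. poly (q - p) x = 0}" using q assms by auto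
    ultimately have "finite ((of_nat :: nat \<Rightarrow> rat) ` {1..})" by (rule finite_subset[rotated])
    then have "finite {1::nat..}" by (rule finite_imageD) (simp add: inj_on_def)
    then show False using infinite_Ici by blast
  qed
qed (use assms in blast)

theorem corollary4p6:
  fixes \<delta> :: "sign list" and n :: nat
  assumes "length \<delta> = n"
    and "2 \<le> count_list \<delta> Plus"
    and "2 \<le> count_list \<delta> Minus"
  shows "smult (fact n) (order_polynomial (vertices \<delta>) (circular_fence \<delta>)) =
         (\<Sum>\<sigma> | \<sigma> permutes {..<n}. monom 1 (bl_circ \<delta> \<sigma>))"
proof -
  define p :: "rat poly" where "p = (\<Sum>\<sigma> | \<sigma> permutes {..<n}. monom 1 (bl_circ \<delta> \<sigma>))"
  have "Minus \<in> set \<delta>" using assms(3) by (metis count_list_0_iff not_numeral_le_zero)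
  note main = fact_times_order_preserving_maps[OF this]
  have "order_polynomial (vertices \<delta>) (circular_fence \<delta>) = smult (1 / fact n) p"
  proof (rule order_polynomial_eqI)
    fix m :: nat assume "1 \<le> m"
    have "poly p (of_nat m) = of_nat (\<Sum>\<sigma> | \<sigma> permutes {..<n}. m ^ bl_circ \<delta> \<sigma>)"
      by (simp add: p_def poly_sum poly_monom)
    also have "\<dots> = fact n * of_nat (card (order_preserving_maps (vertices \<delta>) (circular_fence \<delta>) m))"
      using main[OF \<open>1 \<le> m\<close>] assms(1) by (metis of_nat_fact of_nat_mult)
    finally show "poly (smult (1 / fact n) p) (of_nat m) =
        of_nat (card (order_preserving_maps (vertices \<delta>) (circular_fence \<delta>) m))" by simp
  qed
  then show ?thesis by (simp add: p_def)
qed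

end
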